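(* Let $u, z \in H^1(\Omega,\Gamma_D)$ be the primal and dual solutions, i.e. $u, z \perp \mathscr{H}(\Omega,\Gamma_D)$ in $L^2(\Omega)$ and $$\langle \nabla u, \nabla v\rangle_A = F(v - \mathscr{H}_{\Omega,\Gamma_D}v), \qquad \langle \nabla z, \nabla v\rangle_A = J(v - \mathscr{H}_{\Omega,\Gamma_D}v) \qquad \text{for all } v \in H^1(\Omega,\Gamma_D),$$ where $F, J \in H^{-1}(\Omega,\Gamma_N)$. Let $u_h, z_h \in \mathbf{Q}^r(\Omega_h,\Gamma_D)$ be Galerkin solutions of the primal and dual problems, in the sense that $$\langle \nabla u_h, \nabla v_h\rangle_A = F(v_h - \mathscr{H}_{\Omega,\Gamma_D}v_h), \qquad \langle \nabla z_h, \nabla v_h\rangle_A = J(v_h - \mathscr{H}_{\Omega,\Gamma_D}v_h) \qquad \text{for all } v_h \in \mathbf{Q}^r(\Omega_h,\Gamma_D).$$ Let $\varrho_h, \varpi_h \in \mathbf{RT}^r_{-1}(\Omega_h)$ solve the primal and dual residual flux equations $$ -\operatorname{div}_{\Omega,\Gamma_N} A\varrho_h = F - \mathscr{H}_{\Omega,\Gamma_D}F + \operatorname{div}_{\Omega,\Gamma_N} A\nabla u_h, \qquad -\operatorname{div}_{\Omega,\Gamma_N} A\varpi_h = J - \mathscr{H}_{\Omega,\Gamma_D}J + \operatorname{div}_{\Omega,\Gamma_N} A\nabla z_h, $$ and set $\sigma_h = \varrho_h + \nabla u_h$, $\tau_h = \varpi_h + \nabla z_h$. Then there are unique $\theta_h,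 \zeta_h \in \mathbf{X}(\Omega,\Gamma_N,A)$ with $$\varrho_h = (\nabla u - \nabla u_h) + \theta_h, \qquad \varpi_h = (\nabla z - \nabla z_h) + \zeta_h,$$ and the error in the quantity of interest satisfies $$ J(u - u_h) = \langle \nabla u - \nabla u_h, \nabla z - \nabla z_h\rangle_A = \langle \sigma_h - \nabla u_h, \tau_h - \nabla z_h\rangle_A - \langle \theta_h, \zeta_h\rangle_A = \langle \varrho_h, \varpi_h\rangle_A - \langle \theta_h, \zeta_h\rangle_A. $$
   Context: $\Omega \subset \mathbb{R}^n$ is a bounded Lipschitz domain (not necessarily connected), and $\Gamma_D, \Gamma_N \subseteq \partial\Omega$ are relatively open and disjoint with $\partial\Omega = \overline{\Gamma_D}\cup\overline{\Gamma_N}$. $H^1(\Omega,\Gamma_D)$ is the subspace of $H^1(\Omega)$ of functions with vanishing trace on $\Gamma_D$; $H^{-1}(\Omega,\Gamma_N) := H^1(\Omega,\Gamma_D)^*$. $A \in L^\infty(\Omega)^{n\times n}$ is an admissible metric tensor: symmetric and invertible almost everywhere with $A^{-1} \in L^\infty(\Omega)^{n\times n}$, and such that $\langle\sigma,\tau\rangle_A = \int_\Omega \sigma\cdot A\tau\,dx$ is a scalar product on $L^2(\Omega)^n$ equivalent to the canonical one. $\operatorname{div}_{\Omega,\Gamma_N} : L^2(\Omega)^n \to H^{-1}(\Omega,\Gamma_N)$ is defined by $(-\operatorname{div}_{\Omega,\Gamma_N}\tau)(v) = \int_\Omega \tau\cdot\nabla v\,dx$ for $v \in H^1(\Omega,\Gamma_D)$,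 so $(-\operatorname{div}_{\Omega,\Gamma_N}A\tau)(v) = \langle \tau,\nabla v\rangle_A$. $\mathscr{H}(\Omega,\Gamma_D)$ is the space of locally constant functions in $H^1(\Omega,\Gamma_D)$ (the span of the indicator functions of the connected components of $\Omega$ that do not touch $\Gamma_D$), and $\mathscr{H}_{\Omega,\Gamma_D}$ is the $L^2$-orthogonal projection onto it, extended to functionals $G \in H^{-1}(\Omega,\Gamma_N)$ by $(\mathscr{H}_{\Omega,\Gamma_D}G)(v) = G(\mathscr{H}_{\Omega,\Gamma_D}v)$. To ensure uniqueness of the Galerkin solutions one may in addition enforce $u_h \perp \mathscr{H}(\Omega,\Gamma_D)$ and $z_h \perp \mathscr{H}(\Omega,\Gamma_D)$, but this is not imposed as a hypothesis. $\mathbf{X}(\Omega,\Gamma_N,A) := \{\tau \in L^2(\Omega)^n : \operatorname{div}_{\Omega,\Gamma_N}A\tau = 0\}$, which is the $A$-orthogonal complement of $\nabla H^1(\Omega,\Gamma_D)$ in $L^2(\Omega)^n$. $\Omega_h$ is a finite cubical partition of $\Omega$, a subset of whose faces is a partition of $\Gamma_D$, and $r$ is a fixed non-negative integer. $\mathbf{Q}^r(K)$ denotes the polynomials on a cell $K$ of degree at most $r$ in each variable, and $\mathbf{Q}^r(\Omega_h,\Gamma_D) = \{v \in H^1(\Omega,\Gamma_D) : v|_K \in \mathbf{Q}^r(K) \text{ for all } K\in\Omega_h\}$. $\mathbf{RT}^r(K) = \bigoplus_{i=1}^n (\mathbf{Q}^r(K) + x_i\mathbf{Q}^r(K))$ is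 the Raviart–Thomas space on $K$, and $\mathbf{RT}^r_{-1}(\Omega_h) = \{\tau \in L^2(\Omega)^n : \tau|_K \in \mathbf{RT}^r(K) \text{ for all } K \in \Omega_h\}$. The quantity $\eta^{\varrho\varpi} := \langle\varrho_h,\varpi_h\rangle_A$ is the proposed goal-oriented error estimator, obtained by neglecting $\langle\theta_h,\zeta_h\rangle_A$.
   Formalization: The first equality fails when J does not vanish on the locally constant part of u_h; it is stated for u_h orthogonal to the locally constant functions or J vanishing on them, and in general with the term J(𝓗u_h) added to J(u − u_h). *)

theory Defs
  imports "HOL-Analysis.Analysis"
begin

section \<open>Square-integrable and essentially bounded functions\<close>

text \<open>Elements of $L^p(\Omega)$ are represented by functions that are measurable with respect to
  \<^term>\<open>lebesgue_on \<Omega>\<close>; values outside \<open>\<Omega>\<close> are irrelevant, and equality of classes is written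
  out as equality almost everywhere.\<close>

definition L2_space :: "'a measure \<Rightarrow> ('a \<Rightarrow> 'b::euclidean_space) set" where
  "L2_space M = {f \<in> borel_measurable M. integrable M (\<lambda>x. (norm (f x))\<^sup>2)}"

definition L2_inner :: "'a measure \<Rightarrow> ('a \<Rightarrow> 'b::euclidean_space) \<Rightarrow> ('a \<Rightarrow> 'b) \<Rightarrow> real" where
  "L2_inner M f g = (\<integral>x. f x \<bullet> g x \<partial>M)"

definition L2_norm :: "'a measure \<Rightarrow> ('a \<Rightarrow> 'b::euclidean_space) \<Rightarrow> real" where
  "L2_norm M f = sqrt (L2_inner M f f)"

definition Linf_space :: "'a measure \<Rightarrow> ('a \<Rightarrow> 'b::euclidean_space) set" where
  "Linf_space M = {f \<in> borel_measurable M. \<exists>C. AE x in M. norm (f x) \<le> C}"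

section \<open>Lipschitz domains and surface measure\<close>

text \<open>Near each boundary point the domain is the strict subgraph, in some direction \<open>e\<close>, of a
  Lipschitz function of the component orthogonal to \<open>e\<close>.\<close>

definition lipschitz_domain :: "(real^'n) set \<Rightarrow> bool" where
  "lipschitz_domain \<Omega> \<longleftrightarrow> open \<Omega> \<and> bounded \<Omega> \<and>
     (\<forall>x\<in>frontier \<Omega>. \<exists>U e L g. open U \<and> x \<in> U \<and> norm e = 1 \<and>
        lipschitz_on L UNIV (g :: real^'n \<Rightarrow> real) \<and>
        \<Omega> \<inter> U = {y \<in> U. y \<bullet> e < g (y - (y \<bullet> e) *\<^sub>R e)})"

definition hausdorff_content :: "nat \<Rightarrow> real \<Rightarrow> 'a::metric_space set \<Rightarrow> ennreal" where
  "hausdorff_content s \<delta> A =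
     (INF \<C> \<in> {\<C>. countable \<C> \<and> A \<subseteq> \<Union>\<C> \<and> (\<forall>C\<in>\<C>. C \<noteq> {} \<and> bounded C \<and> diameter C \<le> \<delta>)}.
        \<Sum>\<^sub>\<infinity>C\<in>\<C>. ennreal (unit_ball_vol (real s) * (diameter C / 2) ^ s))"

text \<open>The requirement \<open>C \<noteq> {}\<close> above matters only for \<open>s = 0\<close>, where it gives counting measure.\<close>

definition hausdorff_measure :: "nat \<Rightarrow> 'a::metric_space measure" where
  "hausdorff_measure s = measure_of UNIV (sets borel) (\<lambda>A. SUP \<delta>\<in>{0<..}. hausdorff_content s \<delta> A)"

definition surface_measure :: "(real^'n) set \<Rightarrow> (real^'n) measure" where
  "surface_measure \<Omega> = restrict_space (hausdorff_measure (CARD('n) - 1)) (frontier \<Omega>)"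

definition boundary_partition :: "(real^'n) set \<Rightarrow> (real^'n) set \<Rightarrow> (real^'n) set \<Rightarrow> bool" where
  "boundary_partition \<Omega> \<Gamma>D \<Gamma>N \<longleftrightarrow>
     openin (top_of_set (frontier \<Omega>)) \<Gamma>D \<and> openin (top_of_set (frontier \<Omega>)) \<Gamma>N \<and>
     \<Gamma>D \<inter> \<Gamma>N = {} \<and> frontier \<Omega> = closure \<Gamma>D \<union> closure \<Gamma>N"

section \<open>Sobolev spaces\<close>

definition partial_deriv :: "'n \<Rightarrow> (real^'n \<Rightarrow> real) \<Rightarrow> real^'n \<Rightarrow> real" where
  "partial_deriv i f x = frechet_derivative f (at x) (axis i 1)"

primrec Ck :: "nat \<Rightarrow> (real^'n \<Rightarrow> real) \<Rightarrow> bool" where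
  "Ck 0 f \<longleftrightarrow> continuous_on UNIV f"
| "Ck (Suc k) f \<longleftrightarrow> (\<forall>x. f differentiable (at x)) \<and> (\<forall>i. Ck k (partial_deriv i f))"

definition test_functions :: "(real^'n) set \<Rightarrow> (real^'n \<Rightarrow> real) set" where
  "test_functions \<Omega> = {\<phi>. (\<forall>k. Ck k \<phi>) \<and>
     compact (closure {x. \<phi> x \<noteq> 0}) \<and> closure {x. \<phi> x \<noteq> 0} \<subseteq> \<Omega>}"

definition has_weak_gradient ::
  "(real^'n) set \<Rightarrow> (real^'n \<Rightarrow> real) \<Rightarrow> (real^'n \<Rightarrow> real^'n) \<Rightarrow> bool" where
  "has_weak_gradient \<Omega> v g \<longleftrightarrow> (\<forall>\<phi>\<in>test_functions \<Omega>. \<forall>i.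
     (\<integral>x. v x * partial_deriv i \<phi> x \<partial>lebesgue_on \<Omega>) = - (\<integral>x. g x $ i * \<phi> x \<partial>lebesgue_on \<Omega>))"

definition H1 :: "(real^'n) set \<Rightarrow> (real^'n \<Rightarrow> real) set" where
  "H1 \<Omega> = {v \<in> L2_space (lebesgue_on \<Omega>). \<exists>g\<in>L2_space (lebesgue_on \<Omega>). has_weak_gradient \<Omega> v g}"

definition wgrad :: "(real^'n) set \<Rightarrow> (real^'n \<Rightarrow> real) \<Rightarrow> real^'n \<Rightarrow> real^'n" where
  "wgrad \<Omega> v = (SOME g. g \<in> L2_space (lebesgue_on \<Omega>) \<and> has_weak_gradient \<Omega> v g)"

definition H1_norm :: "(real^'n) set \<Rightarrow> (real^'n \<Rightarrow> real) \<Rightarrow> real" where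
  "H1_norm \<Omega> v =
     sqrt ((L2_norm (lebesgue_on \<Omega>) v)\<^sup>2 + (L2_norm (lebesgue_on \<Omega>) (wgrad \<Omega> v))\<^sup>2)"

text \<open>\<open>has_trace \<Omega> v g\<close> is the graph of the trace operator $H^1(\Omega) \to L^2(\partial\Omega)$, that is, of
  the continuous extension of the restriction map $\phi \mapsto \phi|_{\partial\Omega}$ defined on
  $H^1(\Omega) \cap C(\overline\Omega)$.\<close>

definition has_trace :: "(real^'n) set \<Rightarrow> (real^'n \<Rightarrow> real) \<Rightarrow> (real^'n \<Rightarrow> real) \<Rightarrow> bool" where
  "has_trace \<Omega> v g \<longleftrightarrow> g \<in> L2_space (surface_measure \<Omega>) \<and>
     (\<exists>\<Phi>. (\<forall>k::nat. \<Phi> k \<in> H1 \<Omega> \<and> continuous_on (closure \<Omega>) (\<Phi> k)) \<and>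
        (\<lambda>k. H1_norm \<Omega> (\<lambda>x. \<Phi> k x - v x)) \<longlonglongrightarrow> 0 \<and>
        (\<lambda>k. \<integral>\<^sup>+x. ennreal ((\<Phi> k x - g x)\<^sup>2) \<partial>surface_measure \<Omega>) \<longlonglongrightarrow> 0)"

definition H1D :: "(real^'n) set \<Rightarrow> (real^'n) set \<Rightarrow> (real^'n \<Rightarrow> real) set" where
  "H1D \<Omega> \<Gamma>D = {v \<in> H1 \<Omega>. \<exists>g. has_trace \<Omega> v g \<and>
     (AE x in surface_measure \<Omega>. x \<in> \<Gamma>D \<longrightarrow> g x = 0)}"

text \<open>$H^{-1}(\Omega,\Gamma_N) = H^1(\Omega,\Gamma_D)^*$. Boundedness with respect to the \<open>H1\<close>-norm makes the
  functionals constant on classes of almost everywhere equal functions. The set \<open>\<Gamma>\<^sub>N\<close> enters this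
  space, the divergence and the space \<open>X_space\<close> below only through the test space
  $H^1(\Omega,\Gamma_D)$.\<close>

definition Hminus1 :: "(real^'n) set \<Rightarrow> (real^'n) set \<Rightarrow> ((real^'n \<Rightarrow> real) \<Rightarrow> real) set" where
  "Hminus1 \<Omega> \<Gamma>D = {G.
     (\<forall>v\<in>H1D \<Omega> \<Gamma>D. \<forall>w\<in>H1D \<Omega> \<Gamma>D. G (\<lambda>x. v x + w x) = G v + G w) \<and>
     (\<forall>c. \<forall>v\<in>H1D \<Omega> \<Gamma>D. G (\<lambda>x. c * v x) = c * G v) \<and>
     (\<exists>C. \<forall>v\<in>H1D \<Omega> \<Gamma>D. \<bar>G v\<bar> \<le> C * H1_norm \<Omega> v)}"

definition div_op :: "(real^'n) set \<Rightarrow> (real^'n \<Rightarrow> real^'n) \<Rightarrow> (real^'n \<Rightarrow> real) \<Rightarrow> real" where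
  "div_op \<Omega> \<tau> v = - L2_inner (lebesgue_on \<Omega>) \<tau> (wgrad \<Omega> v)"

section \<open>Locally constant functions and their projection\<close>

definition loc_const :: "(real^'n) set \<Rightarrow> (real^'n) set \<Rightarrow> (real^'n \<Rightarrow> real) set" where
  "loc_const \<Omega> \<Gamma>D = {v \<in> H1D \<Omega> \<Gamma>D. \<exists>c.
     (\<forall>x\<in>\<Omega>. \<exists>U. open U \<and> x \<in> U \<and> c constant_on (U \<inter> \<Omega>)) \<and>
     (AE x in lebesgue_on \<Omega>. v x = c x)}"

definition perp_loc_const :: "(real^'n) set \<Rightarrow> (real^'n) set \<Rightarrow> (real^'n \<Rightarrow> real) \<Rightarrow> bool" where
  "perp_loc_const \<Omega> \<Gamma>D v \<longleftrightarrow> (\<forall>w\<in>loc_const \<Omega> \<Gamma>D. L2_inner (lebesgue_on \<Omega>) v w = 0)"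

definition proj_loc_const ::
  "(real^'n) set \<Rightarrow> (real^'n) set \<Rightarrow> (real^'n \<Rightarrow> real) \<Rightarrow> real^'n \<Rightarrow> real" where
  "proj_loc_const \<Omega> \<Gamma>D v =
     (SOME w. w \<in> loc_const \<Omega> \<Gamma>D \<and> perp_loc_const \<Omega> \<Gamma>D (\<lambda>x. v x - w x))"

definition proj_functional ::
  "(real^'n) set \<Rightarrow> (real^'n) set \<Rightarrow> ((real^'n \<Rightarrow> real) \<Rightarrow> real) \<Rightarrow> (real^'n \<Rightarrow> real) \<Rightarrow> real" where
  "proj_functional \<Omega> \<Gamma>D G v = G (proj_loc_const \<Omega> \<Gamma>D v)"

section \<open>Admissible metric tensors\<close>

definition A_inner :: "(real^'n) set \<Rightarrow> (real^'n \<Rightarrow> real^'n^'n) \<Rightarrow>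
    (real^'n \<Rightarrow> real^'n) \<Rightarrow> (real^'n \<Rightarrow> real^'n) \<Rightarrow> real" where
  "A_inner \<Omega> A \<sigma> \<tau> = (\<integral>x. \<sigma> x \<bullet> (A x *v \<tau> x) \<partial>lebesgue_on \<Omega>)"

definition scalar_product_on_L2 ::
  "'a measure \<Rightarrow> (('a \<Rightarrow> 'b::euclidean_space) \<Rightarrow> ('a \<Rightarrow> 'b) \<Rightarrow> real) \<Rightarrow> bool" where
  "scalar_product_on_L2 M B \<longleftrightarrow>
     (\<forall>f\<in>L2_space M. \<forall>g\<in>L2_space M. B f g = B g f) \<and>
     (\<forall>f\<in>L2_space M. \<forall>g\<in>L2_space M. \<forall>h\<in>L2_space M. B (\<lambda>x. f x + g x) h = B f h + B g h) \<and>
     (\<forall>c. \<forall>f\<in>L2_space M. \<forall>g\<in>L2_space M. B (\<lambda>x. c *\<^sub>R f x) g = c * B f g) \<and>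
     (\<forall>f\<in>L2_space M. B f f \<ge> 0 \<and> (B f f = 0 \<longrightarrow> (AE x in M. f x = 0)))"

definition admissible_metric :: "(real^'n) set \<Rightarrow> (real^'n \<Rightarrow> real^'n^'n) \<Rightarrow> bool" where
  "admissible_metric \<Omega> A \<longleftrightarrow>
     A \<in> Linf_space (lebesgue_on \<Omega>) \<and>
     (AE x in lebesgue_on \<Omega>. transpose (A x) = A x \<and> invertible (A x)) \<and>
     (\<lambda>x. matrix_inv (A x)) \<in> Linf_space (lebesgue_on \<Omega>) \<and>
     scalar_product_on_L2 (lebesgue_on \<Omega>) (A_inner \<Omega> A) \<and>
     (\<exists>c C. 0 < c \<and> 0 < C \<and> (\<forall>\<tau>\<in>L2_space (lebesgue_on \<Omega>).
        c * L2_norm (lebesgue_on \<Omega>) \<tau> \<le> sqrt (A_inner \<Omega> A \<tau> \<tau>) \<and>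
        sqrt (A_inner \<Omega> A \<tau> \<tau>) \<le> C * L2_norm (lebesgue_on \<Omega>) \<tau>))"

definition X_space ::
  "(real^'n) set \<Rightarrow> (real^'n) set \<Rightarrow> (real^'n \<Rightarrow> real^'n^'n) \<Rightarrow> (real^'n \<Rightarrow> real^'n) set" where
  "X_space \<Omega> \<Gamma>D A = {\<tau> \<in> L2_space (lebesgue_on \<Omega>).
     \<forall>v\<in>H1D \<Omega> \<Gamma>D. div_op \<Omega> (\<lambda>x. A x *v \<tau> x) v = 0}"

section \<open>Cubical partitions and finite element spaces\<close>

text \<open>Cells are nondegenerate closed axis-parallel boxes with union $\overline\Omega$ and disjoint
  interiors; hanging nodes are not excluded.\<close>

definition cubical_partition ::
  "(real^'n) set \<Rightarrow> (real^'n) set \<Rightarrow> (real^'n) set set \<Rightarrow> bool" where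
  "cubical_partition \<Omega> \<Gamma>D \<Omega>h \<longleftrightarrow>
     \<Omega>h division_of (closure \<Omega>) \<and> (\<forall>K\<in>\<Omega>h. interior K \<noteq> {}) \<and>
     (\<exists>\<F>. (\<forall>F\<in>\<F>. \<exists>K\<in>\<Omega>h. F facet_of K) \<and> \<Union>\<F> = closure \<Gamma>D \<and>
        (\<forall>F\<in>\<F>. \<forall>F'\<in>\<F>. F \<noteq> F' \<longrightarrow> rel_interior F \<inter> rel_interior F' = {}))"

definition Q_poly :: "nat \<Rightarrow> (real^'n \<Rightarrow> real) set" where
  "Q_poly r = {p. \<exists>c :: ('n \<Rightarrow> nat) \<Rightarrow> real.
     \<forall>x. p x = (\<Sum>\<alpha>\<in>{\<alpha>. \<forall>i. \<alpha> i \<le> r}. c \<alpha> * (\<Prod>i\<in>UNIV. x $ i ^ \<alpha> i))}"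

definition RT_poly :: "nat \<Rightarrow> (real^'n \<Rightarrow> real^'n) set" where
  "RT_poly r = {\<rho>. \<forall>i. \<exists>p\<in>Q_poly r. \<exists>q\<in>Q_poly r. \<forall>x. \<rho> x $ i = p x + x $ i * q x}"

definition Q_space ::
  "nat \<Rightarrow> (real^'n) set \<Rightarrow> (real^'n) set \<Rightarrow> (real^'n) set set \<Rightarrow> (real^'n \<Rightarrow> real) set" where
  "Q_space r \<Omega> \<Gamma>D \<Omega>h = {v \<in> H1D \<Omega> \<Gamma>D.
     \<forall>K\<in>\<Omega>h. \<exists>p\<in>Q_poly r. AE x in lebesgue_on (\<Omega> \<inter> K). v x = p x}"

definition RT_space ::
  "nat \<Rightarrow> (real^'n) set \<Rightarrow> (real^'n) set set \<Rightarrow> (real^'n \<Rightarrow> real^'n) set" where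
  "RT_space r \<Omega> \<Omega>h = {\<tau> \<in> L2_space (lebesgue_on \<Omega>).
     \<forall>K\<in>\<Omega>h. \<exists>\<rho>\<in>RT_poly r. AE x in lebesgue_on (\<Omega> \<inter> K). \<tau> x = \<rho> x}"

text \<open>If neither \<open>u\<^sub>h\<close> is orthogonal to \<open>loc_const \<Omega> \<Gamma>D\<close> nor \<open>J\<close> vanishes there, then \<open>J (u - u\<^sub>h)\<close>
  depends on the locally constant part of the (non-unique) Galerkin solution \<open>u\<^sub>h\<close>, whereas
  \<open>\<langle>\<nabla>u - \<nabla>u\<^sub>h, \<nabla>z - \<nabla>z\<^sub>h\<rangle>\<^sub>A\<close> does not. The two differ exactly by \<open>proj_functional \<Omega> \<Gamma>D J u\<^sub>h\<close>.
  Example: \<open>\<Gamma>\<^sub>D = {}\<close>, \<open>F = 0\<close>, \<open>J v = \<integral>v\<close>, \<open>u = z = z\<^sub>h = 0\<close>, \<open>u\<^sub>h = 1\<close>.\<close>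

end

theory Submission
  imports Defs
begin

text \<open>Testing the residual equation against \<open>v\<close> and subtracting the weak equation for \<open>u\<close> shows
  that \<open>\<rho>\<^sub>h - (\<nabla>u - \<nabla>u\<^sub>h)\<close> is \<open>A\<close>-orthogonal to all gradients of $H^1(\Omega,\Gamma_D)$, and likewise
  for \<open>\<pi>\<^sub>h\<close>; hence the mixed terms of \<open>\<langle>\<rho>\<^sub>h, \<pi>\<^sub>h\<rangle>\<^sub>A\<close> vanish. The representation of
  \<open>J (u - u\<^sub>h)\<close> is the dual equation combined with Galerkin orthogonality against \<open>z\<^sub>h\<close>.
  Splitting \<open>F (v - Pv)\<close> as \<open>F v - F (Pv)\<close> needs that $H^1(\Omega,\Gamma_D)$ is a vector space and
  that the projection \<open>P\<close> exists. The former rests on uniqueness of weak gradients; the latter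
  holds because a locally constant function is constant on the interior of every mesh cell, so
  that there are only finitely many degrees of freedom.\<close>

section \<open>Square-integrable functions\<close>

text \<open>\<open>wgrad\<close> and \<open>proj_loc_const\<close> are choices made by
  \<open>SOME\<close>, and classes of functions are represented by functions, so no linearity comes
  for free. \<open>wgrad\<close> is additive only almost everywhere, and this rests on the
  fundamental lemma of the calculus of variations; as test functions have to be smooth in the sense
  of \<open>Ck\<close>, explicit bumps on boxes are constructed for it. For a function orthogonal to
  the locally constant ones, the projection is only known to be a null function, not the function 0,
  so functionals have to be shown to vanish on null functions. The expansion of the
  \<open>A\<close>-product of the two gradient errors ends in
  \<open>J u - J uh + proj_functional \<Omega> \<Gamma>D J uh\<close>. The last term goes away under
  a normalisation of \<open>uh\<close> or of \<open>J\<close>, hence the two forms of the identity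
  in the conclusion.\<close>

lemma L2_space_measurable [measurable_dest]: "f \<in> L2_space M \<Longrightarrow> f \<in> borel_measurable M"
  by (simp add: L2_space_def)

lemma L2_inner_integrable:
  fixes f g :: "'a \<Rightarrow> 'b::euclidean_space"
  assumes "f \<in> L2_space M" "g \<in> L2_space M"
  shows "integrable M (\<lambda>x. f x \<bullet> g x)"
proof (rule Bochner_Integration.integrable_bound)
  show "integrable M (\<lambda>x. (norm (f x))\<^sup>2 + (norm (g x))\<^sup>2)"
    using assms by (simp add: L2_space_def)
  show "(\<lambda>x. f x \<bullet> g x) \<in> borel_measurable M"
    using assms by measurable
  have "norm (a \<bullet> b) \<le> norm ((norm a)\<^sup>2 + (norm b)\<^sup>2)" for a b :: 'b
  proof -
    have "\<bar>a \<bullet> b\<bar> \<le> norm a * norm b" by (rule Cauchy_Schwarz_ineq2)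
    also have "\<dots> \<le> (norm a)\<^sup>2 + (norm b)\<^sup>2"
      using sum_squares_bound[of "norm a" "norm b"] mult_nonneg_nonneg[OF norm_ge_zero[of a] norm_ge_zero[of b]]
      unfolding mult.assoc by linarith
    finally show ?thesis by simp
  qed
  then show "AE x in M. norm (f x \<bullet> g x) \<le> norm ((norm (f x))\<^sup>2 + (norm (g x))\<^sup>2)"
    by simp
qed

lemma L2_space_add:
  fixes f g :: "'a \<Rightarrow> 'b::euclidean_space"
  assumes "f \<in> L2_space M" "g \<in> L2_space M"
  shows "(\<lambda>x. f x + g x) \<in> L2_space M"
  using assms L2_inner_integrable[OF assms]
  by (auto simp add: L2_space_def power2_norm_eq_inner inner_add_left inner_add_right inner_commute)

lemma L2_space_scaleR:
  fixes f :: "'a \<Rightarrow> 'b::euclidean_space"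
  assumes "f \<in> L2_space M"
  shows "(\<lambda>x. c *\<^sub>R f x) \<in> L2_space M"
  using assms by (auto simp: L2_space_def power_mult_distrib)

lemma L2_space_diff:
  fixes f g :: "'a \<Rightarrow> 'b::euclidean_space"
  assumes "f \<in> L2_space M" "g \<in> L2_space M"
  shows "(\<lambda>x. f x - g x) \<in> L2_space M"
  using L2_space_add[OF assms(1) L2_space_scaleR[OF assms(2), of "-1"]] by simp

lemma L2_space_mult:
  fixes f :: "'a \<Rightarrow> real"
  shows "f \<in> L2_space M \<Longrightarrow> (\<lambda>x. c * f x) \<in> L2_space M"
  using L2_space_scaleR[of f M c] by simp

lemma L2_inner_commute: "L2_inner M f g = L2_inner M g f"
  by (simp add: L2_inner_def inner_commute)

lemma L2_inner_add_left:
  assumes "f \<in> L2_space M" "g \<in> L2_space M" "h \<in> L2_space M"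
  shows "L2_inner M (\<lambda>x. f x + g x) h = L2_inner M f h + L2_inner M g h"
  using assms by (simp add: L2_inner_def inner_add_left L2_inner_integrable)

lemma L2_inner_diff_left:
  assumes "f \<in> L2_space M" "g \<in> L2_space M" "h \<in> L2_space M"
  shows "L2_inner M (\<lambda>x. f x - g x) h = L2_inner M f h - L2_inner M g h"
  using assms by (simp add: L2_inner_def inner_diff_left L2_inner_integrable)

lemma L2_inner_mult_left:
  fixes f :: "'a \<Rightarrow> real"
  shows "L2_inner M (\<lambda>x. c * f x) h = c * L2_inner M f h"
  by (simp add: L2_inner_def mult.assoc)

lemma L2_inner_self_nonneg: "0 \<le> L2_inner M f f"
  by (simp add: L2_inner_def integral_nonneg_AE)

lemma L2_inner_self_eq_0D:
  assumes "f \<in> L2_space M" "L2_inner M f f = 0"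
  shows "AE x in M. f x = 0"
  using integral_nonneg_eq_0_iff_AE[OF L2_inner_integrable[OF assms(1,1)]] assms(2)
  by (simp add: L2_inner_def)

lemma L2_inner_scaleR_self:
  "L2_inner M (\<lambda>x. c *\<^sub>R f x) (\<lambda>x. c *\<^sub>R f x) = c\<^sup>2 * L2_inner M f f"
  by (simp add: L2_inner_def power2_eq_square mult.assoc)

text \<open>The right side exceeds the left one by the integral of the square of
  \<open>f - g\<close>. This crude bound takes the place of the triangle inequality wherever only
  convergence to zero is at stake.\<close>

lemma L2_inner_add_self_le:
  fixes f g :: "'a \<Rightarrow> 'b::euclidean_space"
  assumes "f \<in> L2_space M" "g \<in> L2_space M"
  shows "L2_inner M (\<lambda>x. f x + g x) (\<lambda>x. f x + g x) \<le> 2 * L2_inner M f f + 2 * L2_inner M g g"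
proof -
  have "(a + b) \<bullet> (a + b) \<le> 2 * (a \<bullet> a) + 2 * (b \<bullet> b)" for a b :: 'b
    using inner_ge_zero[of "a - b"]
    by (simp add: inner_add_left inner_add_right inner_diff_left inner_diff_right inner_commute)
  then have "L2_inner M (\<lambda>x. f x + g x) (\<lambda>x. f x + g x)
      \<le> (\<integral>x. 2 * (f x \<bullet> f x) + 2 * (g x \<bullet> g x) \<partial>M)"
    unfolding L2_inner_def
    by (intro integral_mono) (use assms in \<open>simp_all add: L2_inner_integrable L2_space_add\<close>)
  then show ?thesis
    using assms by (simp add: L2_inner_def L2_inner_integrable)
qed

text \<open>Gram--Schmidt, one basis function at a time.\<close>

lemma L2_projection_exists:
  fixes e :: "'k \<Rightarrow> 'a \<Rightarrow> real" and V :: "('a \<Rightarrow> real) set"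
  assumes "finite S" "V \<subseteq> L2_space M" "V \<noteq> {}"
    and "\<And>v w. v \<in> V \<Longrightarrow> w \<in> V \<Longrightarrow> (\<lambda>x. v x + w x) \<in> V"
    and "\<And>c v. v \<in> V \<Longrightarrow> (\<lambda>x. c * v x) \<in> V"
    and "\<And>w. w \<in> V \<Longrightarrow> \<exists>c. AE x in M. w x = (\<Sum>k\<in>S. c k * e k x)"
    and "v \<in> L2_space M"
  shows "\<exists>p\<in>V. \<forall>w\<in>V. L2_inner M (\<lambda>x. v x - p x) w = 0"
  using assms
proof (induction S arbitrary: V v rule: finite_induct)
  case empty
  then obtain p where p: "p \<in> V" by blast
  have "L2_inner M (\<lambda>x. v x - p x) w = 0" if "w \<in> V" for w
  proof -
    have ae: "AE x in M. w x = 0" using empty.prems(5)[OF that] by simp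
    have [measurable]: "v \<in> borel_measurable M" "p \<in> borel_measurable M" "w \<in> borel_measurable M"
      using empty.prems(1,6) p that by (blast dest: L2_space_measurable)+
    have "L2_inner M (\<lambda>x. v x - p x) w = (\<integral>x. 0 \<partial>M)"
      unfolding L2_inner_def by (intro integral_cong_AE) (use ae in auto)
    then show ?thesis by simp
  qed
  then show ?case using p by blast
next
  case (insert k S)
  \<comment> \<open>The functions \<open>e k\<close> need not lie in \<open>V\<close>;
    \<open>V\<close> is merely contained in their span, up to null functions. The induction
    therefore removes one coordinate of the ambient span, and the part \<open>V'\<close> of
    \<open>V\<close> that manages without it has codimension at most one in
    \<open>V\<close>.\<close>
  define V' where "V' = {w \<in> V. \<exists>c. AE x in M. w x = (\<Sum>k\<in>S. c k * e k x)}"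
  note add = insert.prems(3) and mult = insert.prems(4) and v = insert.prems(6)
  have V'V: "V' \<subseteq> V" by (auto simp: V'_def)
  have L2: "w \<in> V \<Longrightarrow> w \<in> L2_space M" for w using insert.prems(1) by blast
  have proj: "\<exists>p\<in>V'. \<forall>w\<in>V'. L2_inner M (\<lambda>x. v x - p x) w = 0" if "v \<in> L2_space M" for v
  proof (rule insert.IH[OF _ _ _ _ _ that])
    show "V' \<subseteq> L2_space M" using V'V L2 by blast
    obtain w where w: "w \<in> V" using insert.prems(2) by blast
    have "(\<lambda>x. 0 * w x) \<in> V'"
      using mult[OF w, of 0] by (auto simp: V'_def intro: exI[of _ "\<lambda>_. 0"])
    then show "V' \<noteq> {}" by blast
  next
    fix f g assume fg: "f \<in> V'" "g \<in> V'"
    then obtain a b where ab: "AE x in M. f x = (\<Sum>k\<in>S. a k * e k x)"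
        "AE x in M. g x = (\<Sum>k\<in>S. b k * e k x)"
      by (auto simp: V'_def)
    have "AE x in M. f x + g x = (\<Sum>k\<in>S. (a k + b k) * e k x)"
      using ab by eventually_elim (simp add: distrib_right sum.distrib)
    then show "(\<lambda>x. f x + g x) \<in> V'"
      using fg add[of f g] by (auto simp: V'_def)
  next
    fix c f assume f: "f \<in> V'"
    then obtain a where a: "AE x in M. f x = (\<Sum>k\<in>S. a k * e k x)"
      by (auto simp: V'_def)
    have "AE x in M. c * f x = (\<Sum>k\<in>S. (c * a k) * e k x)"
      using a by eventually_elim (simp add: sum_distrib_left mult.assoc)
    then show "(\<lambda>x. c * f x) \<in> V'"
      using f mult[of f c] by (auto simp: V'_def)
  next
    fix w assume "w \<in> V'"
    then show "\<exists>c. AE x in M. w x = (\<Sum>k\<in>S. c k * e k x)" by (simp add: V'_def)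
  qed
  show ?case
  proof (cases "V = V'")
    case True
    then show ?thesis using proj[OF v] by simp
  next
    case False
    then obtain w0 where w0: "w0 \<in> V" "w0 \<notin> V'" using V'V by blast
    obtain c0 where c0: "AE x in M. w0 x = (\<Sum>j\<in>insert k S. c0 j * e j x)"
      using insert.prems(5)[OF w0(1)] by blast
    have "c0 k \<noteq> 0"
    proof
      assume "c0 k = 0"
      then have "AE x in M. w0 x = (\<Sum>j\<in>S. c0 j * e j x)" using c0 insert.hyps by simp
      then show False using w0 by (auto simp: V'_def)
    qed
    have decomp: "\<exists>a. (\<lambda>x. w x + a * w0 x) \<in> V'" if w: "w \<in> V" for w
    proof -
      obtain c where c: "AE x in M. w x = (\<Sum>j\<in>insert k S. c j * e j x)"
        using insert.prems(5)[OF w] by blast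
      let ?a = "- c k / c0 k"
      have "AE x in M. w x + ?a * w0 x = (\<Sum>j\<in>S. (c j + ?a * c0 j) * e j x)"
        using c c0
      proof eventually_elim
        case (elim x)
        have "(\<Sum>j\<in>S. (c j + ?a * c0 j) * e j x)
            = (\<Sum>j\<in>S. c j * e j x) + ?a * (\<Sum>j\<in>S. c0 j * e j x)"
          by (simp only: distrib_right sum.distrib sum_distrib_left mult.assoc)
        moreover have "c k * e k x + ?a * (c0 k * e k x) = 0"
          using \<open>c0 k \<noteq> 0\<close> by simp
        ultimately show ?case
          unfolding elim sum.insert[OF insert.hyps] distrib_left by linarith
      qed
      moreover have "(\<lambda>x. w x + ?a * w0 x) \<in> V" using add[OF w mult[OF w0(1)]] .
      ultimately have "(\<lambda>x. w x + ?a * w0 x) \<in> V'"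
        unfolding V'_def by (intro CollectI conjI exI[of _ "\<lambda>j. c j + ?a * c0 j"])
      then show ?thesis by blast
    qed
    obtain p0 where p0: "p0 \<in> V'" "\<And>w. w \<in> V' \<Longrightarrow> L2_inner M (\<lambda>x. w0 x - p0 x) w = 0"
      using proj[OF L2[OF w0(1)]] by blast
    \<comment> \<open>The part of \<open>w0\<close> orthogonal to \<open>V'\<close>. Together with
      \<open>V'\<close> it spans \<open>V\<close>, so the projection onto \<open>V\<close> is the
      projection \<open>q\<close> onto \<open>V'\<close> plus a multiple of
      \<open>w1\<close>.\<close>
    define w1 where "w1 = (\<lambda>x. w0 x - p0 x)"
    have w1: "w1 \<in> V"
      using add[OF w0(1) mult[OF subsetD[OF V'V p0(1)], of "-1"]] by (simp add: w1_def)
    have w1_perp: "L2_inner M w1 w = 0" if "w \<in> V'" for w using p0(2)[OF that] by (simp add: w1_def)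
    obtain q where q: "q \<in> V'" "\<And>w. w \<in> V' \<Longrightarrow> L2_inner M (\<lambda>x. v x - q x) w = 0"
      using proj[OF v] by blast
    have qV: "q \<in> V" using q V'V by blast
    \<comment> \<open>The coefficient of \<open>v - q\<close> along \<open>w1\<close>. If
      \<open>w1\<close> has norm zero, division by zero yields 0, and orthogonality to
      \<open>w1\<close> is then immediate.\<close>
    define d where "d = L2_inner M (\<lambda>x. v x - q x) w1 / L2_inner M w1 w1"
    define p where "p = (\<lambda>x. q x + d * w1 x)"
    have p: "p \<in> V" unfolding p_def by (rule add[OF qV mult[OF w1]])
    have vp: "(\<lambda>x. v x - p x) = (\<lambda>x. (v x - q x) - d * w1 x)" by (auto simp: p_def)
    have vq: "(\<lambda>x. v x - q x) \<in> L2_space M" using v qV L2 by (simp add: L2_space_diff)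
    have inner_vp: "L2_inner M (\<lambda>x. v x - p x) w
        = L2_inner M (\<lambda>x. v x - q x) w - d * L2_inner M w1 w" if "w \<in> V" for w
      unfolding vp using L2_inner_diff_left[OF vq L2_space_mult[OF L2[OF w1]] L2[OF that]]
      by (simp add: L2_inner_mult_left)
    have perp_w1: "L2_inner M (\<lambda>x. v x - p x) w1 = 0"
    proof (cases "L2_inner M w1 w1 = 0")
      case True
      then have ae: "AE x in M. w1 x = 0" using L2_inner_self_eq_0D L2 w1 by blast
      have [measurable]: "v \<in> borel_measurable M" "p \<in> borel_measurable M"
          "w1 \<in> borel_measurable M"
        using v L2[OF p] L2[OF w1] by (blast dest: L2_space_measurable)+
      have "L2_inner M (\<lambda>x. v x - p x) w1 = (\<integral>x. 0 \<partial>M)"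
        unfolding L2_inner_def by (intro integral_cong_AE) (use ae in auto)
      then show ?thesis by simp
    next
      case False
      then show ?thesis unfolding inner_vp[OF w1] by (simp add: d_def)
    qed
    have perp_V': "L2_inner M (\<lambda>x. v x - p x) w = 0" if "w \<in> V'" for w
      using inner_vp that V'V q(2) w1_perp by auto
    have "L2_inner M (\<lambda>x. v x - p x) w = 0" if w: "w \<in> V" for w
    proof -
      obtain a where a: "(\<lambda>x. w x + a * w0 x) \<in> V'" using decomp[OF w] by blast
      define w' where "w' = (\<lambda>x. w x + a * w0 x)"
      have in_L2: "w' \<in> L2_space M" "p0 \<in> L2_space M" "w1 \<in> L2_space M"
          "(\<lambda>x. v x - p x) \<in> L2_space M"
        using L2[OF subsetD[OF V'V a]] L2[OF subsetD[OF V'V p0(1)]] L2[OF w1]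
          L2_space_diff[OF v L2[OF p]] by (simp_all only: w'_def)
      have w_eq: "w = (\<lambda>x. w' x - a * (p0 x + w1 x))" by (simp add: w'_def w1_def)
      have "L2_inner M (\<lambda>x. w' x - a * (p0 x + w1 x)) (\<lambda>x. v x - p x) = L2_inner M w' (\<lambda>x. v x - p x)
         - a * (L2_inner M p0 (\<lambda>x. v x - p x) + L2_inner M w1 (\<lambda>x. v x - p x))"
        using in_L2
        by (simp add: L2_inner_diff_left L2_inner_mult_left L2_inner_add_left L2_space_mult L2_space_add)
      then show ?thesis
        using perp_V'[OF a] perp_V'[OF p0(1)] perp_w1
        unfolding w_eq[symmetric] w'_def[symmetric] by (simp add: L2_inner_commute[of M _ "\<lambda>x. v x - p x"])
    qed
    then show ?thesis using p by blast
  qed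
qed

section \<open>Smooth bump functions on boxes\<close>

text \<open>The division by \<open>t ^ k\<close> makes the family closed under differentiation, up to linear
  combinations.\<close>

definition flat :: "real \<Rightarrow> nat \<Rightarrow> real \<Rightarrow> real" where
  "flat s k t = (if t \<le> 0 then 0 else exp (- (s / t)) / t ^ k)"

text \<open>With \<open>y = s / t\<close> the function becomes \<open>y ^ k / exp y\<close>, up to
  the factor \<open>s ^ k\<close>, and \<open>y\<close> tends to infinity as \<open>t\<close>
  decreases to 0.\<close>

lemma flat_tendsto_0:
  assumes "s > 0"
  shows "(flat s k \<longlongrightarrow> 0) (at_right 0)"
proof -
  have "filterlim (\<lambda>t. s / t) at_top (at_right 0)"
    using assms by (intro LIM_at_top_divide[of _ s]) (auto simp: eventually_at_right_less)
  then have "((\<lambda>t. (s / t) ^ k / exp (s / t)) \<longlongrightarrow> 0) (at_right 0)"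
    by (rule filterlim_compose[OF tendsto_power_div_exp_0])
  then have "((\<lambda>t. (s / t) ^ k / exp (s / t) / s ^ k) \<longlongrightarrow> 0 / s ^ k) (at_right 0)"
    by (intro tendsto_divide) (use assms in auto)
  then have "((\<lambda>t. (s / t) ^ k / exp (s / t) / s ^ k) \<longlongrightarrow> 0) (at_right 0)" by simp
  then show ?thesis
    by (rule Lim_transform_eventually)
      (use assms in \<open>auto simp: eventually_at_filter flat_def exp_minus power_divide field_simps
        intro!: always_eventually\<close>)
qed

lemma flat_has_derivative:
  assumes s: "s > 0"
  shows "(flat s k has_real_derivative s * flat s (k + 2) t - real k * flat s (k + 1) t) (at t)"
proof -
  consider "t < 0" | "t = 0" | "t > 0" by linarith
  then show ?thesis
  proof cases
    case 1
    have "((\<lambda>_. 0) has_real_derivative 0) (at t)" by simp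
    then have "(flat s k has_real_derivative 0) (at t)"
      by (rule has_field_derivative_transform_within_open[of _ _ _ "{..<0}"])
        (use 1 in \<open>auto simp: flat_def\<close>)
    then show ?thesis using 1 by (simp add: flat_def)
  next
    case 2
    \<comment> \<open>For \<open>h > 0\<close> the difference quotient of \<open>flat s k\<close> at
      0 is \<open>flat s (Suc k) h\<close>, so the gluing point is covered by the limit for the next
      exponent.\<close>
    have right: "((\<lambda>h. (flat s k h - flat s k 0) / (h - 0)) \<longlongrightarrow> 0) (at_right 0)"
      by (rule Lim_transform_eventually[OF flat_tendsto_0[OF s, of "Suc k"]])
        (auto simp: eventually_at_filter flat_def intro!: always_eventually)
    have left: "((\<lambda>h. (flat s k h - flat s k 0) / (h - 0)) \<longlongrightarrow> 0) (at_left 0)"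
      by (rule Lim_transform_eventually[OF tendsto_const])
        (auto simp: eventually_at_filter flat_def intro!: always_eventually)
    have "(flat s k has_real_derivative 0) (at 0)"
      unfolding has_field_derivative_iff using left right by (simp add: filterlim_split_at)
    then show ?thesis using 2 by (simp add: flat_def)
  next
    case 3
    have "((\<lambda>t. exp (- (s / t))) has_real_derivative exp (- (s / t)) * (s / t\<^sup>2)) (at t)"
      using 3 by (auto intro!: derivative_eq_intros simp: power2_eq_square)
    \<comment> \<open>For \<open>k = 0\<close> the truncated exponent \<open>k - Suc 0\<close> is
      harmless because of the factor \<open>real k\<close>.\<close>
    moreover have "((\<lambda>t. inverse t ^ k) has_real_derivative
        real k * (- (inverse t ^ Suc (Suc 0)) * inverse t ^ (k - Suc 0))) (at t)"
      using DERIV_power[OF DERIV_inverse[of t], of k] 3 by simp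
    ultimately have "((\<lambda>t. exp (- (s / t)) * inverse t ^ k) has_real_derivative
        exp (- (s / t)) * (s / t\<^sup>2) * inverse t ^ k
        + real k * (- (inverse t ^ Suc (Suc 0)) * inverse t ^ (k - Suc 0)) * exp (- (s / t))) (at t)"
      by (rule DERIV_mult)
    also have "exp (- (s / t)) * (s / t\<^sup>2) * inverse t ^ k
        + real k * (- (inverse t ^ Suc (Suc 0)) * inverse t ^ (k - Suc 0)) * exp (- (s / t))
        = s * flat s (k + 2) t - real k * flat s (k + 1) t"
      using 3 by (cases k) (simp_all add: flat_def field_simps power2_eq_square)
    finally show ?thesis
      by (rule has_field_derivative_transform_within_open[of _ _ _ "{0<..}"])
        (use 3 in \<open>auto simp: flat_def field_simps\<close>)
  qed
qed

text \<open>At each fixed \<open>t > 0\<close>, \<open>exp (- (s / t))\<close> tends to 1 as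
  \<open>s\<close> tends to 0. This is the purpose of the parameter \<open>s\<close>: it drives the
  bumps towards indicators of boxes.\<close>

lemma flat_tendsto_indicator: "(\<lambda>m. flat (1 / real (Suc m)) 0 t) \<longlonglongrightarrow> indicator {0<..} t"
proof (cases "t > 0")
  case True
  have "(\<lambda>m. exp (- (1 / real (Suc m) / t))) \<longlonglongrightarrow> exp (- (0 / t))"
    by (intro tendsto_intros LIMSEQ_Suc[OF lim_1_over_n]) (use True in auto)
  then show ?thesis using True by (simp add: flat_def)
qed (simp add: flat_def)

lemma flat_0_bounds: "s > 0 \<Longrightarrow> 0 \<le> flat s 0 t \<and> flat s 0 t \<le> 1"
  by (auto simp: flat_def)

text \<open>An algebra of functions whose partial derivatives stay in the algebra, which therefore
  consists of smooth functions.\<close>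

inductive_set flat_algebra :: "real \<Rightarrow> (real^'n \<Rightarrow> real) set" for s where
  const: "(\<lambda>x. c) \<in> flat_algebra s"
| left: "(\<lambda>x. flat s k (x $ i - a)) \<in> flat_algebra s"
| right: "(\<lambda>x. flat s k (a - x $ i)) \<in> flat_algebra s"
| add: "f \<in> flat_algebra s \<Longrightarrow> g \<in> flat_algebra s \<Longrightarrow> (\<lambda>x. f x + g x) \<in> flat_algebra s"
| mult: "f \<in> flat_algebra s \<Longrightarrow> g \<in> flat_algebra s \<Longrightarrow> (\<lambda>x. f x * g x) \<in> flat_algebra s"

text \<open>Although only the \<open>i\<close>-th coordinate contributes, the derivative is written
  as a sum over all of them, the format in which \<open>flat_algebra_derivative\<close> reads off
  partial derivatives. The map \<open>l\<close> will be \<open>x $ i - a\<close> or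
  \<open>a - x $ i\<close>, with \<open>c\<close> equal to 1 or -1.\<close>

lemma flat_algebra_coordinate:
  fixes i :: "'n::finite"
  assumes "\<And>t. (h has_real_derivative D t) (at t)"
    and "\<And>x. (l has_derivative (\<lambda>v. c * v $ i)) (at x)"
  shows "((\<lambda>x. h (l x)) has_derivative (\<lambda>v. \<Sum>j\<in>UNIV. v $ j * (if j = i then c * D (l x) else 0))) (at x)"
proof -
  have "((\<lambda>x. h (l x)) has_derivative (\<lambda>v. D (l x) * (c * v $ i))) (at x)"
    by (rule has_derivative_compose[OF assms(2) assms(1)[unfolded has_field_derivative_def]])
  then show ?thesis by (simp add: if_distrib mult.commute mult.left_commute cong: if_cong)
qed

lemma flat_algebra_derivative:
  fixes f :: "real^'n \<Rightarrow> real"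
  assumes "f \<in> flat_algebra s" and s: "s > 0"
  shows "\<exists>D. (\<forall>x. (f has_derivative (\<lambda>v. \<Sum>i\<in>UNIV. v $ i * D i x)) (at x)) \<and>
    (\<forall>i. D i \<in> flat_algebra s)"
  using assms(1)
proof induction
  case (const c)
  then show ?case by (intro exI[of _ "\<lambda>i x. 0"]) (auto intro: flat_algebra.const)
next
  case (left k i a)
  \<comment> \<open>The algebra has no rule for differences, so the derivative is rewritten with
    sums and constant factors.\<close>
  let ?D = "\<lambda>t. s * flat s (k + 2) t + (- real k) * flat s (k + 1) t"
  have l: "((\<lambda>x. x $ i - a) has_derivative (\<lambda>v. 1 * v $ i)) (at x)" for x :: "real^'n"
    by (auto intro!: derivative_eq_intros bounded_linear.has_derivative[OF bounded_linear_vec_nth])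
  have h: "(flat s k has_real_derivative ?D t) (at t)" for t
    using flat_has_derivative[OF s, of k t] by simp
  show ?case
  proof (intro exI conjI allI)
    fix x :: "real^'n" and j
    show "((\<lambda>x. flat s k (x $ i - a)) has_derivative (\<lambda>v. \<Sum>j\<in>UNIV. v $ j *
        (\<lambda>j x. if j = i then 1 * ?D (x $ i - a) else 0) j x)) (at x)"
      by (rule flat_algebra_coordinate[OF h l])
    show "(\<lambda>j x. if j = i then 1 * ?D (x $ i - a) else 0) j \<in> flat_algebra s"
      by (cases "j = i") (simp_all only: simp_thms if_True if_False, intro flat_algebra.intros, rule flat_algebra.const)
  qed
next
  case (right k a i)
  let ?D = "\<lambda>t. s * flat s (k + 2) t + (- real k) * flat s (k + 1) t"
  have l: "((\<lambda>x. a - x $ i) has_derivative (\<lambda>v. (- 1) * v $ i)) (at x)" for x :: "real^'n"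
    by (auto intro!: derivative_eq_intros bounded_linear.has_derivative[OF bounded_linear_vec_nth])
  have h: "(flat s k has_real_derivative ?D t) (at t)" for t
    using flat_has_derivative[OF s, of k t] by simp
  show ?case
  proof (intro exI conjI allI)
    fix x :: "real^'n" and j
    show "((\<lambda>x. flat s k (a - x $ i)) has_derivative (\<lambda>v. \<Sum>j\<in>UNIV. v $ j *
        (\<lambda>j x. if j = i then (- 1) * ?D (a - x $ i) else 0) j x)) (at x)"
      by (rule flat_algebra_coordinate[OF h l])
    show "(\<lambda>j x. if j = i then (- 1) * ?D (a - x $ i) else 0) j \<in> flat_algebra s"
      by (cases "j = i") (simp_all only: simp_thms if_True if_False, intro flat_algebra.intros, rule flat_algebra.const)
  qed
next
  case (add f g)
  then obtain D E where D: "\<And>x. (f has_derivative (\<lambda>v. \<Sum>i\<in>UNIV. v $ i * D i x)) (at x)"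
      "\<And>i. D i \<in> flat_algebra s"
    and E: "\<And>x. (g has_derivative (\<lambda>v. \<Sum>i\<in>UNIV. v $ i * E i x)) (at x)"
      "\<And>i. E i \<in> flat_algebra s"
    by blast
  show ?case
  proof (intro exI conjI allI)
    show "((\<lambda>x. f x + g x) has_derivative (\<lambda>v. \<Sum>i\<in>UNIV. v $ i * (\<lambda>i x. D i x + E i x) i x)) (at x)"
      for x
      using has_derivative_add[OF D(1) E(1), of x] by (simp add: distrib_left sum.distrib)
    show "(\<lambda>i x. D i x + E i x) i \<in> flat_algebra s" for i
      by (rule flat_algebra.add[OF D(2) E(2)])
  qed
next
  case (mult f g)
  then obtain D E where D: "\<And>x. (f has_derivative (\<lambda>v. \<Sum>i\<in>UNIV. v $ i * D i x)) (at x)"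
      "\<And>i. D i \<in> flat_algebra s"
    and E: "\<And>x. (g has_derivative (\<lambda>v. \<Sum>i\<in>UNIV. v $ i * E i x)) (at x)"
      "\<And>i. E i \<in> flat_algebra s"
    by blast
  show ?case
  proof (intro exI conjI allI)
    show "((\<lambda>x. f x * g x) has_derivative
        (\<lambda>v. \<Sum>i\<in>UNIV. v $ i * (\<lambda>i x. f x * E i x + D i x * g x) i x)) (at x)" for x
      using has_derivative_mult[OF D(1) E(1), of x]
      by (simp add: distrib_left sum.distrib sum_distrib_left sum_distrib_right mult.assoc mult.left_commute)
    show "(\<lambda>i x. f x * E i x + D i x * g x) i \<in> flat_algebra s" for i
      by (intro flat_algebra.add flat_algebra.mult mult.hyps D E)
  qed
qed

lemma flat_algebra_Ck:
  fixes f :: "real^'n \<Rightarrow> real"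
  assumes "f \<in> flat_algebra s" and s: "s > 0"
  shows "Ck k f"
  using assms(1)
proof (induction k arbitrary: f)
  case 0
  then have "\<And>x. f differentiable (at x)"
    using flat_algebra_derivative[OF 0 s] by (auto simp: differentiable_def)
  then show ?case
    by (simp add: continuous_at_imp_continuous_on differentiable_imp_continuous_within)
next
  case (Suc k)
  obtain D where D: "\<And>x. (f has_derivative (\<lambda>v. \<Sum>i\<in>UNIV. v $ i * D i x)) (at x)"
      "\<And>i. D i \<in> flat_algebra s"
    using flat_algebra_derivative[OF Suc.prems s] by blast
  have "partial_deriv i f = D i" for i
  proof
    fix x
    show "partial_deriv i f x = D i x"
      unfolding partial_deriv_def frechet_derivative_at[OF D(1), symmetric]
      by (simp add: axis_def if_distrib if_distribR cong: if_cong)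
  qed
  then show ?case using Suc.IH[OF D(2)] D(1) by (auto simp: differentiable_def)
qed

text \<open>For \<open>s > 0\<close> each factor vanishes to infinite order at one face, so the
  product is smooth although it is positive exactly on \<open>box a b\<close>. Boxes suit the
  purpose because they form an intersection-stable generator of the Borel sets.\<close>

definition bump :: "real \<Rightarrow> real^'n \<Rightarrow> real^'n \<Rightarrow> real^'n \<Rightarrow> real" where
  "bump s a b x = (\<Prod>i\<in>UNIV. flat s 0 (x $ i - a $ i) * flat s 0 (b $ i - x $ i))"

lemma bump_in_test_functions:
  assumes s: "s > 0" and sub: "cbox a b \<subseteq> \<Omega>"
  shows "bump s a b \<in> test_functions \<Omega>"
proof -
  have "(\<lambda>x. \<Prod>i\<in>I. flat s 0 (x $ i - a $ i) * flat s 0 (b $ i - x $ i)) \<in> flat_algebra s"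
    if "finite I" for I
    using that
  proof induction
    case (insert i I)
    then show ?case by (simp add: flat_algebra.intros)
  qed (simp add: flat_algebra.const)
  from this[of UNIV] have "bump s a b \<in> flat_algebra s" by (simp add: bump_def[abs_def])
  then have Ck: "Ck k (bump s a b)" for k using flat_algebra_Ck s by blast
  have "{x. bump s a b x \<noteq> 0} \<subseteq> cbox a b"
    by (auto simp: bump_def flat_def mem_box_cart not_le less_imp_le)
  then have sub': "closure {x. bump s a b x \<noteq> 0} \<subseteq> cbox a b"
    by (rule closure_minimal) (rule closed_cbox)
  have "compact (closure {x. bump s a b x \<noteq> 0})"
    using compact_Int_closed[OF compact_cbox closed_closure] sub' by (metis inf.absorb2)
  then show ?thesis using Ck sub sub' by (auto simp: test_functions_def)
qed

lemma bump_bounds: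
  assumes "s > 0"
  shows "0 \<le> bump s a b x \<and> bump s a b x \<le> 1"
  unfolding bump_def
  using flat_0_bounds[OF assms] by (auto intro!: prod_nonneg prod_le_1 mult_le_one)

lemma bump_tendsto_indicator:
  "(\<lambda>m. bump (1 / real (Suc m)) a b x) \<longlonglongrightarrow> indicator (box a b) x"
proof -
  have "(\<lambda>m. bump (1 / real (Suc m)) a b x) \<longlonglongrightarrow>
      (\<Prod>i\<in>UNIV. indicator {0<..} (x $ i - a $ i) * indicator {0<..} (b $ i - x $ i))"
    unfolding bump_def by (intro tendsto_intros flat_tendsto_indicator)
  also have "(\<Prod>i\<in>UNIV. indicator {0<..} (x $ i - a $ i) * indicator {0<..} (b $ i - x $ i))
      = indicat_real (box a b) x"
  proof (cases "x \<in> box a b")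
    case False
    then obtain i where "\<not> (a $ i < x $ i \<and> x $ i < b $ i)" by (auto simp: mem_box_cart)
    then have "indicat_real {0<..} (x $ i - a $ i) * indicat_real {0<..} (b $ i - x $ i) = 0"
      by (auto simp: indicator_def)
    then show ?thesis using False by (auto simp: prod_zero_iff intro!: exI[of _ i])
  qed (auto simp: mem_box_cart)
  finally show ?thesis .
qed

section \<open>The fundamental lemma of the calculus of variations\<close>

text \<open>The Borel sets over which the integral vanishes include the boxes, which are stable
  under intersection, and are closed under complements and countable disjoint unions; by Dynkin's
  argument they are all Borel sets. Assumption \<open>univ\<close> serves the complements, as the
  whole space is not a box.\<close>

lemma AE_zero_if_box_integrals_zero:
  fixes h :: "'a::euclidean_space \<Rightarrow> real"
  assumes h: "integrable lebesgue h"
    and univ: "(\<integral>x. h x \<partial>lebesgue) = 0"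
    and box: "\<And>a b. (\<integral>x. indicator (box a b) x * h x \<partial>lebesgue) = 0"
  shows "AE x in lebesgue. h x = 0"
proof -
  \<comment> \<open>\<open>h\<close> is only Lebesgue measurable, whereas boxes generate the Borel
    sets; \<open>g\<close> is a Borel representative.\<close>
  obtain g where g [measurable]: "g \<in> borel_measurable lborel" and hg: "AE x in lborel. h x = g x"
    using completion_ex_borel_measurable_real[OF borel_measurable_integrable[OF h]] by auto
  have hg': "AE x in lebesgue. h x = g x" by (rule AE_completion[OF hg])
  have g_leb [measurable]: "g \<in> borel_measurable lebesgue" by (rule measurable_completion[OF g])
  note [measurable] = borel_measurable_integrable[OF h]
  have [measurable]: "box a b \<in> sets lebesgue" for a b :: 'a by simp
  have "integrable lebesgue g"
    using h hg' by (subst integrable_cong_AE[symmetric, where f = h]) auto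
  then have g_int: "integrable lborel g" by (simp add: integrable_completion)
  have g_UNIV: "(\<integral>x. g x \<partial>lborel) = 0"
    using univ hg' integral_cong_AE[of h lebesgue g] by (simp add: integral_completion)
  have g_box: "(\<integral>x\<in>box a b. g x \<partial>lborel) = 0" for a b :: 'a
  proof -
    have "(\<integral>x. indicator (box a b) x * g x \<partial>lebesgue) = 0"
      unfolding box[of a b, symmetric] by (intro integral_cong_AE) (use hg' in auto)
    then show ?thesis by (simp add: set_lebesgue_integral_def integral_completion)
  qed
  have g_sets: "(\<integral>x\<in>A. g x \<partial>lborel) = 0" if "A \<in> sets lborel" for A
  proof -
    have "Int_stable (range (\<lambda>(a, b). box a b :: 'a set))"
      by (auto simp: Int_stable_def box_Int_box)
    moreover have "(range (\<lambda>(a, b). box a b)) \<subseteq> Pow (UNIV :: 'a set)" by auto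
    moreover have "A \<in> sigma_sets UNIV (range (\<lambda>(a, b). box a b))"
      using that unfolding sets_lborel borel_eq_box by simp
    ultimately show ?thesis
    proof (induction rule: sigma_sets_induct_disjoint)
      case (basic A)
      then show ?case using g_box by auto
    next
      case empty
      then show ?case by (simp add: set_lebesgue_integral_def)
    next
      case (compl A)
      then have [measurable]: "A \<in> sets borel" by (simp add: borel_eq_box)
      have "(\<integral>x\<in>A. g x \<partial>lborel) + (\<integral>x\<in>UNIV - A. g x \<partial>lborel) = (\<integral>x\<in>A \<union> (UNIV - A). g x \<partial>lborel)"
        using integrable_mult_indicator[OF _ g_int]
        by (intro set_integral_Un[symmetric]) (auto simp: set_integrable_def)
      then show ?case using compl g_UNIV by (simp add: set_lebesgue_integral_def)
    next
      case (union A)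
      then have [measurable]: "\<And>i. A i \<in> sets borel" by (simp add: borel_eq_box subset_eq)
      have "(\<integral>x\<in>(\<Union>i. A i). g x \<partial>lborel) = (\<Sum>i. (\<integral>x\<in>A i. g x \<partial>lborel))"
        using union(1) integrable_mult_indicator[OF _ g_int]
        by (intro lebesgue_integral_countable_add)
          (auto simp: disjoint_family_on_def set_integrable_def)
      then show ?case using union by simp
    qed
  qed
  have "AE x in lborel. g x = 0"
    by (rule density_unique_real[OF g_int]) (use g_sets in \<open>auto simp: set_lebesgue_integral_def\<close>)
  with hg have "AE x in lborel. h x = 0" by eventually_elim simp
  then show ?thesis by (rule AE_completion)
qed

lemma test_functions_continuous: "\<phi> \<in> test_functions \<Omega> \<Longrightarrow> continuous_on UNIV \<phi>"
  unfolding test_functions_def by (auto dest: spec[of _ 0])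

text \<open>Bumps converge to the indicator of an open box whose closed box lies in \<Omega>, so by
  dominated convergence the integral over that box vanishes. This localises the problem to closed
  boxes in \<Omega>, countably many of which cover \<Omega>.\<close>

lemma AE_zero_if_test_integrals_zero:
  fixes f :: "real^'n \<Rightarrow> real"
  assumes "open \<Omega>" and f: "integrable (lebesgue_on \<Omega>) f"
    and test: "\<And>\<phi>. \<phi> \<in> test_functions \<Omega> \<Longrightarrow> (\<integral>x. f x * \<phi> x \<partial>lebesgue_on \<Omega>) = 0"
  shows "AE x in lebesgue_on \<Omega>. f x = 0"
proof -
  have \<Omega> [measurable, simp]: "\<Omega> \<in> sets lebesgue" using \<open>open \<Omega>\<close> by simp
  define F where "F x = indicator \<Omega> x * f x" for x
  have F: "integrable lebesgue F"
    using f by (simp add: F_def[abs_def] integrable_restrict_space)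
  note [measurable] = borel_measurable_integrable[OF F]
  have F_box: "(\<integral>x. indicator (box a b) x * F x \<partial>lebesgue) = 0" if "cbox a b \<subseteq> \<Omega>" for a b
  proof -
    let ?\<phi> = "\<lambda>m. bump (1 / real (Suc m)) a b"
    have \<phi>: "?\<phi> m \<in> test_functions \<Omega>" for m
      by (intro bump_in_test_functions that) simp
    have [measurable]: "box a b \<in> sets lebesgue" by simp
    have [measurable]: "?\<phi> m \<in> borel_measurable lebesgue" for m
      using borel_measurable_continuous_onI[OF test_functions_continuous[OF \<phi>]]
      by (intro measurable_completion) simp
    have "(\<lambda>m. \<integral>x. ?\<phi> m x * F x \<partial>lebesgue) \<longlonglongrightarrow> (\<integral>x. indicator (box a b) x * F x \<partial>lebesgue)"
    proof (rule integral_dominated_convergence)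
      show "integrable lebesgue (\<lambda>x. \<bar>F x\<bar>)" using F by simp
      show "AE x in lebesgue. (\<lambda>m. ?\<phi> m x * F x) \<longlonglongrightarrow> indicator (box a b) x * F x"
        by (intro AE_I2 tendsto_mult bump_tendsto_indicator tendsto_const)
      show "AE x in lebesgue. norm (?\<phi> m x * F x) \<le> \<bar>F x\<bar>" for m
        using bump_bounds[of "1 / real (Suc m)" a b]
        by (auto simp: abs_mult intro!: mult_left_le_one_le)
    qed (simp_all del: of_nat_Suc)
    moreover have "(\<integral>x. ?\<phi> m x * F x \<partial>lebesgue) = 0" for m
      using test[OF \<phi>[of m]] by (simp add: integral_restrict_space F_def ac_simps)
    ultimately show ?thesis by (simp add: LIMSEQ_const_iff)
  qed
  have F_cbox: "AE x in lebesgue. x \<in> cbox a b \<longrightarrow> F x = 0" if sub: "cbox a b \<subseteq> \<Omega>" for a b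
  proof -
    \<comment> \<open>The criterion asks for integrals over all boxes of the space; the factor
      \<open>indicator (box a b)\<close> turns them into integrals over boxes inside
      \<Omega>.\<close>
    have "AE x in lebesgue. indicator (box a b) x * F x = 0"
    proof (rule AE_zero_if_box_integrals_zero)
      show "integrable lebesgue (\<lambda>x. indicator (box a b) x * F x)"
        using integrable_mult_indicator[OF _ F, of "box a b"] by simp
      show "(\<integral>x. indicator (box a b) x * F x \<partial>lebesgue) = 0" by (rule F_box[OF sub])
      fix c d :: "real^'n"
      obtain u v where uv: "box c d \<inter> box a b = box u v" by (simp only: box_Int_box)
      \<comment> \<open>If \<open>box u v\<close> is empty, \<open>cbox u v\<close> may be a
        degenerate box that is not contained in \<Omega>, so \<open>F_box\<close> is applied only to
        nonempty intersections.\<close>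
      have "(\<integral>x. indicator (box u v) x * F x \<partial>lebesgue) = 0"
      proof (cases "box u v = {}")
        case False
        then have "cbox u v \<subseteq> closure (box a b)"
          using uv by (metis closure_box closure_mono inf_le2)
        also have "\<dots> \<subseteq> \<Omega>"
          using sub by (metis box_subset_cbox closed_cbox closure_minimal order_trans)
        finally show ?thesis by (rule F_box)
      qed simp
      then show "(\<integral>x. indicator (box c d) x * (indicator (box a b) x * F x) \<partial>lebesgue) = 0"
        by (simp add: uv[symmetric] indicator_inter_arith mult.assoc)
    qed
    moreover have "AE x in lebesgue. x \<notin> cbox a b - box a b"
      using negligible_frontier_interval[of a b]
      by (intro AE_not_in) (simp add: negligible_iff_null_sets)
    ultimately show ?thesis by eventually_elim (auto simp: indicator_def)
  qed
  obtain \<D> where \<D>: "countable \<D>" "\<D> \<subseteq> Pow \<Omega>" "\<And>X. X \<in> \<D> \<Longrightarrow> \<exists>a b. X = cbox a b" "\<Union>\<D> = \<Omega>"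
    using open_countable_Union_open_cbox[OF \<open>open \<Omega>\<close>] by blast
  have "AE x in lebesgue. \<forall>X\<in>\<D>. x \<in> X \<longrightarrow> F x = 0"
    using \<D>(1)
  proof (rule AE_ball_countable'[rotated])
    fix X assume "X \<in> \<D>"
    then obtain a b where "X = cbox a b" "cbox a b \<subseteq> \<Omega>" using \<D>(2,3) by blast
    then show "AE x in lebesgue. x \<in> X \<longrightarrow> F x = 0" using F_cbox by simp
  qed
  then have "AE x in lebesgue. x \<in> \<Omega> \<longrightarrow> f x = 0"
    by eventually_elim (use \<D>(4) in \<open>auto simp: F_def indicator_def split: if_splits\<close>)
  then show ?thesis by (simp add: AE_restrict_space_iff)
qed

section \<open>Vector space structure of the Sobolev spaces\<close>

lemma L2_space_vec_nth:
  fixes g :: "'a \<Rightarrow> real^'n"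
  assumes "g \<in> L2_space M"
  shows "(\<lambda>x. g x $ i) \<in> L2_space M"
proof -
  have meas [measurable]: "(\<lambda>x. g x $ i) \<in> borel_measurable M"
    using borel_measurable_inner[OF L2_space_measurable[OF assms] borel_measurable_const, of "axis i 1"]
    by (simp add: inner_axis)
  have "integrable M (\<lambda>x. (norm (g x $ i))\<^sup>2)"
    by (rule Bochner_Integration.integrable_bound[of _ "\<lambda>x. (norm (g x))\<^sup>2"])
      (use assms in \<open>auto simp: L2_space_def component_le_norm_cart intro!: AE_I2 power_mono abs_le_square_iff[THEN iffD1]\<close>)
  then show ?thesis using meas by (simp add: L2_space_def)
qed

lemma has_weak_gradient_mult:
  "has_weak_gradient \<Omega> v g \<Longrightarrow> has_weak_gradient \<Omega> (\<lambda>x. c * v x) (\<lambda>x. c *\<^sub>R g x)"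
  unfolding has_weak_gradient_def by (simp add: mult.assoc)

lemma H1_L2: "v \<in> H1 \<Omega> \<Longrightarrow> v \<in> L2_space (lebesgue_on \<Omega>)"
  by (simp add: H1_def)

lemma wgrad:
  assumes "v \<in> H1 \<Omega>"
  shows "wgrad \<Omega> v \<in> L2_space (lebesgue_on \<Omega>)" "has_weak_gradient \<Omega> v (wgrad \<Omega> v)"
proof -
  have "\<exists>g. g \<in> L2_space (lebesgue_on \<Omega>) \<and> has_weak_gradient \<Omega> v g"
    using assms by (auto simp: H1_def)
  from someI_ex[OF this]
  show "wgrad \<Omega> v \<in> L2_space (lebesgue_on \<Omega>)" "has_weak_gradient \<Omega> v (wgrad \<Omega> v)"
    by (simp_all add: wgrad_def)
qed

lemma L2_inner_cong_AE:
  assumes "f \<in> borel_measurable M" "g \<in> borel_measurable M" "AE x in M. f x = g x"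
  shows "L2_inner M f f = L2_inner M g g"
  unfolding L2_inner_def using assms by (intro integral_cong_AE) auto

lemma H1_norm_power2:
  "(H1_norm \<Omega> v)\<^sup>2 = L2_inner (lebesgue_on \<Omega>) v v + L2_inner (lebesgue_on \<Omega>) (wgrad \<Omega> v) (wgrad \<Omega> v)"
  by (simp add: H1_norm_def L2_norm_def L2_inner_self_nonneg)

lemma H1_norm_nonneg: "0 \<le> H1_norm \<Omega> v"
  by (simp add: H1_norm_def)

text \<open>Sums and multiples are estimated through squares of the norm, so convergence has to be
  passed to squares and back.\<close>

lemma tendsto_H1_norm_0_iff:
  "((\<lambda>k. H1_norm \<Omega> (f k)) \<longlonglongrightarrow> 0) \<longleftrightarrow> ((\<lambda>k. (H1_norm \<Omega> (f k))\<^sup>2) \<longlonglongrightarrow> 0)"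
proof
  assume "(\<lambda>k. (H1_norm \<Omega> (f k))\<^sup>2) \<longlonglongrightarrow> 0"
  then have "(\<lambda>k. sqrt ((H1_norm \<Omega> (f k))\<^sup>2)) \<longlonglongrightarrow> sqrt 0" by (rule tendsto_real_sqrt)
  then show "(\<lambda>k. H1_norm \<Omega> (f k)) \<longlonglongrightarrow> 0" by (simp add: H1_norm_nonneg)
next
  assume "(\<lambda>k. H1_norm \<Omega> (f k)) \<longlonglongrightarrow> 0"
  from tendsto_power[OF this, of 2] show "(\<lambda>k. (H1_norm \<Omega> (f k))\<^sup>2) \<longlonglongrightarrow> 0" by simp
qed

context
  fixes \<Omega> :: "(real^'n) set"
  assumes open_domain: "open \<Omega>" and bounded_domain: "bounded \<Omega>"
begin

text \<open>Such a function is bounded on the compact closure, and \<Omega> has finite measure. It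
  makes products of L2 functions with test functions and their derivatives integrable, as additivity
  of the Bochner integral requires.\<close>

lemma continuous_in_L2_space:
  fixes \<psi> :: "real^'n \<Rightarrow> real"
  assumes "continuous_on UNIV \<psi>"
  shows "\<psi> \<in> L2_space (lebesgue_on \<Omega>)"
proof -
  have "compact (\<psi> ` closure \<Omega>)"
    using assms bounded_domain
    by (intro compact_continuous_image) (auto intro: continuous_on_subset simp: compact_closure)
  then have "bounded (\<psi> ` closure \<Omega>)" by (rule compact_imp_bounded)
  then obtain B where B: "\<And>x. x \<in> closure \<Omega> \<Longrightarrow> norm (\<psi> x) \<le> B"
    by (auto simp: bounded_iff)
  have meas [measurable]: "\<psi> \<in> borel_measurable (lebesgue_on \<Omega>)"
    using borel_measurable_continuous_onI[OF assms]
    by (intro measurable_restrict_space1 measurable_completion) simp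
  interpret finite_measure "lebesgue_on \<Omega>"
    by (rule finite_measure_lebesgue_on) (simp add: lmeasurable_open open_domain bounded_domain)
  have "(norm (\<psi> x))\<^sup>2 \<le> B\<^sup>2" if "x \<in> \<Omega>" for x
    using B[of x] closure_subset[of \<Omega>] that by (intro power_mono) auto
  then have "integrable (lebesgue_on \<Omega>) (\<lambda>x. (norm (\<psi> x))\<^sup>2)"
    by (intro integrable_const_bound[of _ "B\<^sup>2"] AE_I2) auto
  then show ?thesis using meas by (simp add: L2_space_def)
qed

lemma integrable_L2_times_continuous:
  fixes f \<psi> :: "real^'n \<Rightarrow> real"
  assumes "f \<in> L2_space (lebesgue_on \<Omega>)" "continuous_on UNIV \<psi>"
  shows "integrable (lebesgue_on \<Omega>) (\<lambda>x. f x * \<psi> x)"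
  using L2_inner_integrable[OF assms(1) continuous_in_L2_space[OF assms(2)]] by simp

lemma test_functions_continuous_partial_deriv:
  "\<phi> \<in> test_functions \<Omega> \<Longrightarrow> continuous_on UNIV (partial_deriv i \<phi>)"
  unfolding test_functions_def by (auto dest: spec[of _ "Suc 0"])

lemma has_weak_gradient_add:
  assumes "v \<in> L2_space (lebesgue_on \<Omega>)" "w \<in> L2_space (lebesgue_on \<Omega>)"
    and "g \<in> L2_space (lebesgue_on \<Omega>)" "h \<in> L2_space (lebesgue_on \<Omega>)"
    and "has_weak_gradient \<Omega> v g" "has_weak_gradient \<Omega> w h"
  shows "has_weak_gradient \<Omega> (\<lambda>x. v x + w x) (\<lambda>x. g x + h x)"
  using assms unfolding has_weak_gradient_def
  by (simp add: distrib_right integrable_L2_times_continuous L2_space_vec_nth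
      test_functions_continuous test_functions_continuous_partial_deriv)

text \<open>Each component of \<open>g - h\<close> integrates to zero against every test function,
  so the fundamental lemma applies. This is what makes the arbitrary choice \<open>wgrad\<close>
  linear almost everywhere.\<close>

lemma has_weak_gradient_unique:
  assumes g: "g \<in> L2_space (lebesgue_on \<Omega>)" "has_weak_gradient \<Omega> v g"
    and h: "h \<in> L2_space (lebesgue_on \<Omega>)" "has_weak_gradient \<Omega> v h"
  shows "AE x in lebesgue_on \<Omega>. g x = h x"
proof -
  have "AE x in lebesgue_on \<Omega>. g x $ i - h x $ i = 0" for i
  proof (rule AE_zero_if_test_integrals_zero[OF open_domain])
    note gi = L2_space_vec_nth[OF g(1), of i] and hi = L2_space_vec_nth[OF h(1), of i]
    \<comment> \<open>The constant 1 is square-integrable on the bounded set \<Omega>, so L2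
      functions are integrable there.\<close>
    show "integrable (lebesgue_on \<Omega>) (\<lambda>x. g x $ i - h x $ i)"
      using integrable_L2_times_continuous[OF L2_space_diff[OF gi hi], of "\<lambda>_. 1"] by simp
    fix \<phi> assume \<phi>: "\<phi> \<in> test_functions \<Omega>"
    show "(\<integral>x. (g x $ i - h x $ i) * \<phi> x \<partial>lebesgue_on \<Omega>) = 0"
      using g(2) h(2) \<phi> gi hi unfolding has_weak_gradient_def
      by (simp add: left_diff_distrib integrable_L2_times_continuous test_functions_continuous)
  qed
  then have "AE x in lebesgue_on \<Omega>. \<forall>i\<in>UNIV. g x $ i - h x $ i = 0"
    by (intro AE_ball_countable') auto
  then show ?thesis by eventually_elim (simp add: vec_eq_iff)
qed

lemma H1_add:
  assumes "v \<in> H1 \<Omega>" "w \<in> H1 \<Omega>"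
  shows "(\<lambda>x. v x + w x) \<in> H1 \<Omega>"
    and "AE x in lebesgue_on \<Omega>. wgrad \<Omega> (\<lambda>x. v x + w x) x = wgrad \<Omega> v x + wgrad \<Omega> w x"
proof -
  note sum = has_weak_gradient_add[OF H1_L2 H1_L2 wgrad(1) wgrad(1) wgrad(2) wgrad(2), of v w]
    L2_space_add[OF wgrad(1) wgrad(1), of v \<Omega> w]
  show "(\<lambda>x. v x + w x) \<in> H1 \<Omega>"
    using assms sum L2_space_add[OF H1_L2 H1_L2, of v \<Omega> w] by (auto simp: H1_def)
  from has_weak_gradient_unique[OF wgrad[OF this]] assms sum
  show "AE x in lebesgue_on \<Omega>. wgrad \<Omega> (\<lambda>x. v x + w x) x = wgrad \<Omega> v x + wgrad \<Omega> w x"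
    by blast
qed

lemma H1_mult:
  assumes "v \<in> H1 \<Omega>"
  shows "(\<lambda>x. c * v x) \<in> H1 \<Omega>"
    and "AE x in lebesgue_on \<Omega>. wgrad \<Omega> (\<lambda>x. c * v x) x = c *\<^sub>R wgrad \<Omega> v x"
proof -
  note scaled = has_weak_gradient_mult[OF wgrad(2)[OF assms], of c]
    L2_space_scaleR[OF wgrad(1)[OF assms], of c]
  show "(\<lambda>x. c * v x) \<in> H1 \<Omega>"
    using assms scaled L2_space_mult[OF H1_L2, of v \<Omega> c] by (auto simp: H1_def)
  from has_weak_gradient_unique[OF wgrad[OF this]] scaled
  show "AE x in lebesgue_on \<Omega>. wgrad \<Omega> (\<lambda>x. c * v x) x = c *\<^sub>R wgrad \<Omega> v x"
    by blast
qed

lemma H1_norm_add_power2: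
  assumes "v \<in> H1 \<Omega>" "w \<in> H1 \<Omega>"
  shows "(H1_norm \<Omega> (\<lambda>x. v x + w x))\<^sup>2 \<le> 2 * (H1_norm \<Omega> v)\<^sup>2 + 2 * (H1_norm \<Omega> w)\<^sup>2"
proof -
  have "L2_inner (lebesgue_on \<Omega>) (wgrad \<Omega> (\<lambda>x. v x + w x)) (wgrad \<Omega> (\<lambda>x. v x + w x))
      = L2_inner (lebesgue_on \<Omega>) (\<lambda>x. wgrad \<Omega> v x + wgrad \<Omega> w x) (\<lambda>x. wgrad \<Omega> v x + wgrad \<Omega> w x)"
    using assms
    by (intro L2_inner_cong_AE L2_space_measurable L2_space_add H1_add wgrad(1))
  then show ?thesis
    unfolding H1_norm_power2
    using L2_inner_add_self_le[OF H1_L2 H1_L2, of v \<Omega> w] L2_inner_add_self_le[OF wgrad(1) wgrad(1), of v \<Omega> w] assms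
    by simp
qed

lemma H1_norm_mult_power2:
  assumes "v \<in> H1 \<Omega>"
  shows "(H1_norm \<Omega> (\<lambda>x. c * v x))\<^sup>2 = c\<^sup>2 * (H1_norm \<Omega> v)\<^sup>2"
proof -
  have "L2_inner (lebesgue_on \<Omega>) (wgrad \<Omega> (\<lambda>x. c * v x)) (wgrad \<Omega> (\<lambda>x. c * v x))
      = L2_inner (lebesgue_on \<Omega>) (\<lambda>x. c *\<^sub>R wgrad \<Omega> v x) (\<lambda>x. c *\<^sub>R wgrad \<Omega> v x)"
    using assms
    by (intro L2_inner_cong_AE L2_space_measurable L2_space_scaleR H1_mult wgrad(1))
  then show ?thesis
    unfolding H1_norm_power2
    using L2_inner_scaleR_self[of "lebesgue_on \<Omega>" c v]
    by (simp add: L2_inner_scaleR_self distrib_left)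
qed

lemma H1_diff:
  assumes "v \<in> H1 \<Omega>" "w \<in> H1 \<Omega>"
  shows "(\<lambda>x. v x - w x) \<in> H1 \<Omega>"
  using H1_add(1)[OF assms(1) H1_mult(1)[OF assms(2), of "- 1"]] by simp

text \<open>By construction \<open>hausdorff_measure\<close> carries the Borel sigma-algebra, so
  this is Borel measurability on the frontier, which lies in the closure.\<close>

lemma surface_measurable_continuous:
  assumes "continuous_on (closure \<Omega>) f"
  shows "f \<in> borel_measurable (surface_measure \<Omega>)"
proof -
  have "f \<in> borel_measurable (restrict_space borel (frontier \<Omega>))"
    using assms by (intro borel_measurable_continuous_on_restrict continuous_on_subset[OF assms])
      (auto simp: frontier_def)
  moreover have "sets (surface_measure \<Omega>) = sets (restrict_space borel (frontier \<Omega>))"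
    unfolding surface_measure_def
    by (intro sets_restrict_space_cong)
      (simp add: hausdorff_measure_def sets.sigma_sets_eq[of borel, simplified])
  ultimately show ?thesis using measurable_cong_sets by blast
qed

text \<open>The sums of the two approximating sequences are again continuous on the closure. Bounds
  by twice the sum of squares give convergence, both in \<open>H1_norm\<close> and for the
  \<open>ennreal\<close>-valued surface integrals.\<close>

lemma has_trace_add:
  assumes v: "v \<in> H1 \<Omega>" "has_trace \<Omega> v g" and w: "w \<in> H1 \<Omega>" "has_trace \<Omega> w h"
  shows "has_trace \<Omega> (\<lambda>x. v x + w x) (\<lambda>x. g x + h x)"
proof -
  let ?M = "surface_measure \<Omega>"
  obtain \<Phi> where \<Phi>: "\<And>k::nat. \<Phi> k \<in> H1 \<Omega>" "\<And>k. continuous_on (closure \<Omega>) (\<Phi> k)"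
      "(\<lambda>k. H1_norm \<Omega> (\<lambda>x. \<Phi> k x - v x)) \<longlonglongrightarrow> 0"
      "(\<lambda>k. \<integral>\<^sup>+x. ennreal ((\<Phi> k x - g x)\<^sup>2) \<partial>?M) \<longlonglongrightarrow> 0"
    using v(2) unfolding has_trace_def by blast
  obtain \<Psi> where \<Psi>: "\<And>k::nat. \<Psi> k \<in> H1 \<Omega>" "\<And>k. continuous_on (closure \<Omega>) (\<Psi> k)"
      "(\<lambda>k. H1_norm \<Omega> (\<lambda>x. \<Psi> k x - w x)) \<longlonglongrightarrow> 0"
      "(\<lambda>k. \<integral>\<^sup>+x. ennreal ((\<Psi> k x - h x)\<^sup>2) \<partial>?M) \<longlonglongrightarrow> 0"
    using w(2) unfolding has_trace_def by blast
  have g: "g \<in> L2_space ?M" and h: "h \<in> L2_space ?M"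
    using v w by (auto simp: has_trace_def)
  note [measurable] = L2_space_measurable[OF g] L2_space_measurable[OF h]
    surface_measurable_continuous[OF \<Phi>(2)] surface_measurable_continuous[OF \<Psi>(2)]
  define S where "S k = (\<lambda>x. \<Phi> k x + \<Psi> k x)" for k
  have "(\<lambda>k. 2 * (H1_norm \<Omega> (\<lambda>x. \<Phi> k x - v x))\<^sup>2 + 2 * (H1_norm \<Omega> (\<lambda>x. \<Psi> k x - w x))\<^sup>2) \<longlonglongrightarrow> 2 * 0\<^sup>2 + 2 * 0\<^sup>2"
    by (intro tendsto_intros \<Phi> \<Psi>)
  then have "(\<lambda>k. 2 * (H1_norm \<Omega> (\<lambda>x. \<Phi> k x - v x))\<^sup>2 + 2 * (H1_norm \<Omega> (\<lambda>x. \<Psi> k x - w x))\<^sup>2) \<longlonglongrightarrow> 0"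
    by simp
  then have "(\<lambda>k. (H1_norm \<Omega> (\<lambda>x. (\<Phi> k x - v x) + (\<Psi> k x - w x)))\<^sup>2) \<longlonglongrightarrow> 0"
    by (rule tendsto_sandwich[OF _ _ tendsto_const, rotated 2])
      (use v(1) w(1) \<Phi>(1) \<Psi>(1) in \<open>auto intro!: always_eventually H1_norm_add_power2 H1_diff\<close>)
  then have "(\<lambda>k. H1_norm \<Omega> (\<lambda>x. (\<Phi> k x - v x) + (\<Psi> k x - w x))) \<longlonglongrightarrow> 0"
    by (simp only: tendsto_H1_norm_0_iff)
  moreover have "(\<lambda>x. (\<Phi> k x - v x) + (\<Psi> k x - w x)) = (\<lambda>x. S k x - (v x + w x))" for k
    by (auto simp: S_def)
  ultimately have norm: "(\<lambda>k. H1_norm \<Omega> (\<lambda>x. S k x - (v x + w x))) \<longlonglongrightarrow> 0" by simp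
  have "(\<lambda>k. 2 * (\<integral>\<^sup>+x. ennreal ((\<Phi> k x - g x)\<^sup>2) \<partial>?M) + 2 * (\<integral>\<^sup>+x. ennreal ((\<Psi> k x - h x)\<^sup>2) \<partial>?M))
      \<longlonglongrightarrow> 2 * 0 + 2 * 0"
    by (intro tendsto_add ennreal_tendsto_cmult \<Phi> \<Psi>) auto
  then have lim: "(\<lambda>k. 2 * (\<integral>\<^sup>+x. ennreal ((\<Phi> k x - g x)\<^sup>2) \<partial>?M) + 2 * (\<integral>\<^sup>+x. ennreal ((\<Psi> k x - h x)\<^sup>2) \<partial>?M))
      \<longlonglongrightarrow> 0" by simp
  have le: "(\<integral>\<^sup>+x. ennreal ((S k x - (g x + h x))\<^sup>2) \<partial>?M)
      \<le> 2 * (\<integral>\<^sup>+x. ennreal ((\<Phi> k x - g x)\<^sup>2) \<partial>?M) + 2 * (\<integral>\<^sup>+x. ennreal ((\<Psi> k x - h x)\<^sup>2) \<partial>?M)" for k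
  proof -
    have sq: "(a + b)\<^sup>2 \<le> 2 * a\<^sup>2 + 2 * b\<^sup>2" for a b :: real
      using zero_le_power2[of "a - b"] by (simp add: power2_diff power2_sum)
    have "ennreal ((S k x - (g x + h x))\<^sup>2) \<le> 2 * ennreal ((\<Phi> k x - g x)\<^sup>2) + 2 * ennreal ((\<Psi> k x - h x)\<^sup>2)" for x
    proof -
      have "(S k x - (g x + h x))\<^sup>2 \<le> 2 * (\<Phi> k x - g x)\<^sup>2 + 2 * (\<Psi> k x - h x)\<^sup>2"
        using sq[of "\<Phi> k x - g x" "\<Psi> k x - h x"] by (simp add: S_def algebra_simps)
      then have "ennreal ((S k x - (g x + h x))\<^sup>2) \<le> ennreal (2 * (\<Phi> k x - g x)\<^sup>2 + 2 * (\<Psi> k x - h x)\<^sup>2)"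
        by (rule ennreal_leI)
      then show ?thesis by (simp add: ennreal_plus ennreal_mult)
    qed
    then have "(\<integral>\<^sup>+x. ennreal ((S k x - (g x + h x))\<^sup>2) \<partial>?M)
        \<le> (\<integral>\<^sup>+x. 2 * ennreal ((\<Phi> k x - g x)\<^sup>2) + 2 * ennreal ((\<Psi> k x - h x)\<^sup>2) \<partial>?M)"
      by (intro nn_integral_mono)
    then show ?thesis by (simp add: nn_integral_add nn_integral_cmult)
  qed
  have trace: "(\<lambda>k. \<integral>\<^sup>+x. ennreal ((S k x - (g x + h x))\<^sup>2) \<partial>?M) \<longlonglongrightarrow> 0"
    by (rule tendsto_sandwich[OF _ _ tendsto_const lim]) (use le in auto)
  show ?thesis
    unfolding has_trace_def
    using L2_space_add[OF g h] H1_add(1)[OF \<Phi>(1) \<Psi>(1)] \<Phi>(2) \<Psi>(2) norm trace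
    by (intro conjI exI[of _ S]) (auto simp: S_def intro!: continuous_intros)
qed

lemma has_trace_mult:
  assumes v: "v \<in> H1 \<Omega>" "has_trace \<Omega> v g"
  shows "has_trace \<Omega> (\<lambda>x. c * v x) (\<lambda>x. c * g x)"
proof -
  let ?M = "surface_measure \<Omega>"
  obtain \<Phi> where \<Phi>: "\<And>k::nat. \<Phi> k \<in> H1 \<Omega>" "\<And>k. continuous_on (closure \<Omega>) (\<Phi> k)"
      "(\<lambda>k. H1_norm \<Omega> (\<lambda>x. \<Phi> k x - v x)) \<longlonglongrightarrow> 0"
      "(\<lambda>k. \<integral>\<^sup>+x. ennreal ((\<Phi> k x - g x)\<^sup>2) \<partial>?M) \<longlonglongrightarrow> 0"
    using v(2) unfolding has_trace_def by blast
  have g: "g \<in> L2_space ?M" using v by (auto simp: has_trace_def)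
  note [measurable] = L2_space_measurable[OF g] surface_measurable_continuous[OF \<Phi>(2)]
  have "(\<lambda>k. c\<^sup>2 * (H1_norm \<Omega> (\<lambda>x. \<Phi> k x - v x))\<^sup>2) \<longlonglongrightarrow> c\<^sup>2 * 0\<^sup>2"
    by (intro tendsto_intros \<Phi>)
  then have "(\<lambda>k. (H1_norm \<Omega> (\<lambda>x. c * (\<Phi> k x - v x)))\<^sup>2) \<longlonglongrightarrow> 0"
    using v(1) \<Phi>(1) by (simp add: H1_norm_mult_power2 H1_diff)
  then have norm: "(\<lambda>k. H1_norm \<Omega> (\<lambda>x. c * \<Phi> k x - c * v x)) \<longlonglongrightarrow> 0"
    by (simp only: tendsto_H1_norm_0_iff right_diff_distrib)
  have "(\<integral>\<^sup>+x. ennreal ((c * \<Phi> k x - c * g x)\<^sup>2) \<partial>?M) = ennreal (c\<^sup>2) * (\<integral>\<^sup>+x. ennreal ((\<Phi> k x - g x)\<^sup>2) \<partial>?M)" for k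
    by (simp add: right_diff_distrib[symmetric] power_mult_distrib ennreal_mult nn_integral_cmult)
  moreover have "(\<lambda>k. ennreal (c\<^sup>2) * (\<integral>\<^sup>+x. ennreal ((\<Phi> k x - g x)\<^sup>2) \<partial>?M)) \<longlonglongrightarrow> ennreal (c\<^sup>2) * 0"
    by (intro ennreal_tendsto_cmult \<Phi>) auto
  ultimately have trace: "(\<lambda>k. \<integral>\<^sup>+x. ennreal ((c * \<Phi> k x - c * g x)\<^sup>2) \<partial>?M) \<longlonglongrightarrow> 0" by simp
  show ?thesis
    unfolding has_trace_def
    using L2_space_mult[OF g] H1_mult(1)[OF \<Phi>(1)] \<Phi>(2) norm trace
    by (intro conjI exI[of _ "\<lambda>k x. c * \<Phi> k x"]) (auto intro!: continuous_intros)
qed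

lemma H1D_add:
  assumes "v \<in> H1D \<Omega> \<Gamma>D" "w \<in> H1D \<Omega> \<Gamma>D"
  shows "(\<lambda>x. v x + w x) \<in> H1D \<Omega> \<Gamma>D"
proof -
  obtain g h where gh: "has_trace \<Omega> v g" "AE x in surface_measure \<Omega>. x \<in> \<Gamma>D \<longrightarrow> g x = 0"
      "has_trace \<Omega> w h" "AE x in surface_measure \<Omega>. x \<in> \<Gamma>D \<longrightarrow> h x = 0"
    using assms by (auto simp: H1D_def)
  from gh(2,4) have "AE x in surface_measure \<Omega>. x \<in> \<Gamma>D \<longrightarrow> g x + h x = 0"
    by eventually_elim simp
  then show ?thesis using assms gh has_trace_add H1_add(1) unfolding H1D_def by blast
qed

lemma H1D_mult:
  assumes "v \<in> H1D \<Omega> \<Gamma>D"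
  shows "(\<lambda>x. c * v x) \<in> H1D \<Omega> \<Gamma>D"
proof -
  obtain g where g: "has_trace \<Omega> v g" "AE x in surface_measure \<Omega>. x \<in> \<Gamma>D \<longrightarrow> g x = 0"
    using assms by (auto simp: H1D_def)
  from g(2) have "AE x in surface_measure \<Omega>. x \<in> \<Gamma>D \<longrightarrow> c * g x = 0"
    by eventually_elim simp
  then show ?thesis using assms g has_trace_mult H1_mult(1) unfolding H1D_def by blast
qed

end

section \<open>Locally constant functions\<close>

text \<open>The part of \<open>U\<close> strictly above the Lipschitz graph is open and disjoint from \<open>\<Omega>\<close>, so a
  boundary point, pushed upwards, leaves the closure.\<close>

lemma lipschitz_domain_interior_closure:
  assumes "lipschitz_domain \<Omega>"
  shows "interior (closure \<Omega>) \<subseteq> \<Omega>"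
proof
  fix x assume x: "x \<in> interior (closure \<Omega>)"
  show "x \<in> \<Omega>"
  proof (rule ccontr)
    assume "x \<notin> \<Omega>"
    have "open \<Omega>" using assms by (simp add: lipschitz_domain_def)
    have "x \<in> frontier \<Omega>"
      using x \<open>x \<notin> \<Omega>\<close> \<open>open \<Omega>\<close> interior_subset by (auto simp: frontier_def interior_open)
    from bspec[OF conjunct2[OF conjunct2[OF assms[unfolded lipschitz_domain_def]]] this]
    obtain U e L g where U: "open U" "x \<in> U" and e: "norm e = 1"
      and g: "lipschitz_on L UNIV (g :: real^'a \<Rightarrow> real)"
      and eq: "\<Omega> \<inter> U = {y \<in> U. y \<bullet> e < g (y - (y \<bullet> e) *\<^sub>R e)}"
      by blast
    have above: "g (x - (x \<bullet> e) *\<^sub>R e) \<le> x \<bullet> e"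
      using eq \<open>x \<notin> \<Omega>\<close> \<open>x \<in> U\<close> by force
    have "continuous_on UNIV g" using g by (rule lipschitz_on_continuous_on)
    then have cont: "continuous_on UNIV (\<lambda>y. g (y - (y \<bullet> e) *\<^sub>R e))"
      by (rule continuous_on_compose2) (auto intro!: continuous_intros)
    define W where "W = U \<inter> {y. g (y - (y \<bullet> e) *\<^sub>R e) < y \<bullet> e}"
    have "open W"
      unfolding W_def using U(1) cont
      by (intro open_Int open_Collect_less) (auto intro!: continuous_intros)
    moreover have "W \<inter> \<Omega> = {}" using eq by (force simp: W_def)
    ultimately have disjoint: "W \<inter> closure \<Omega> = {}" by (simp add: open_Int_closure_eq_empty)
    have "open (U \<inter> interior (closure \<Omega>))" using U by auto
    then obtain \<delta> where \<delta>: "\<delta> > 0" "ball x \<delta> \<subseteq> U \<inter> interior (closure \<Omega>)"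
      using U(2) x open_contains_ball by blast
    \<comment> \<open>Half the radius stays inside the ball, and moving along the unit vector
      \<open>e\<close> keeps the component orthogonal to \<open>e\<close>, hence the height of the
      graph.\<close>
    define y where "y = x + (\<delta> / 2) *\<^sub>R e"
    have "y \<in> ball x \<delta>" using \<delta>(1) e by (simp add: y_def dist_norm)
    then have y: "y \<in> U" "y \<in> closure \<Omega>" using \<delta>(2) interior_subset by blast+
    have ye: "y \<bullet> e = x \<bullet> e + \<delta> / 2"
      using e by (simp add: y_def inner_add_left norm_eq_1)
    have "y - (y \<bullet> e) *\<^sub>R e = x - (x \<bullet> e) *\<^sub>R e"
      unfolding ye by (simp add: y_def scaleR_add_left)
    then have "y \<in> W" using above ye \<delta>(1) y(1) by (simp add: W_def)
    then show False using disjoint y(2) by blast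
  qed
qed

lemma locally_constant_imp_constant_on:
  fixes c :: "'a::topological_space \<Rightarrow> 'b"
  assumes "connected S" "S \<subseteq> \<Omega>"
    and "\<And>x. x \<in> \<Omega> \<Longrightarrow> \<exists>U. open U \<and> x \<in> U \<and> c constant_on (U \<inter> \<Omega>)"
  shows "c constant_on S"
proof -
  show ?thesis
  proof (rule locally_constant_imp_constant[OF assms(1)])
    fix a assume "a \<in> S"
    then obtain U where U: "open U" "a \<in> U" "c constant_on (U \<inter> \<Omega>)" using assms(2,3) by blast
    show "\<exists>T. openin (top_of_set S) T \<and> a \<in> T \<and> (\<forall>x\<in>T. c x = c a)"
      using U \<open>a \<in> S\<close> assms(2)
      by (intro exI[of _ "S \<inter> U"]) (auto simp: constant_on_def subset_iff openin_open_Int)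
  qed
qed

lemma loc_const_add:
  assumes "open \<Omega>" "bounded \<Omega>" and "v \<in> loc_const \<Omega> \<Gamma>D" "w \<in> loc_const \<Omega> \<Gamma>D"
  shows "(\<lambda>x. v x + w x) \<in> loc_const \<Omega> \<Gamma>D"
proof -
  obtain c d where c: "\<forall>x\<in>\<Omega>. \<exists>U. open U \<and> x \<in> U \<and> c constant_on (U \<inter> \<Omega>)" "AE x in lebesgue_on \<Omega>. v x = c x"
    and d: "\<forall>x\<in>\<Omega>. \<exists>U. open U \<and> x \<in> U \<and> d constant_on (U \<inter> \<Omega>)" "AE x in lebesgue_on \<Omega>. w x = d x"
    using assms by (auto simp: loc_const_def)
  have "\<exists>U. open U \<and> x \<in> U \<and> (\<lambda>x. c x + d x) constant_on (U \<inter> \<Omega>)" if x: "x \<in> \<Omega>" for x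
  proof -
    obtain U V where U: "open U" "x \<in> U" "c constant_on (U \<inter> \<Omega>)"
      and V: "open V" "x \<in> V" "d constant_on (V \<inter> \<Omega>)"
      using c d x by metis
    have "(\<lambda>x. c x + d x) constant_on (U \<inter> V \<inter> \<Omega>)"
      using U(3) V(3) unfolding constant_on_def by (metis IntD1 IntD2 IntI)
    then show ?thesis using U V by (intro exI[of _ "U \<inter> V"]) auto
  qed
  moreover have "AE x in lebesgue_on \<Omega>. v x + w x = c x + d x"
    using c(2) d(2) by eventually_elim simp
  ultimately show ?thesis
    using assms H1D_add unfolding loc_const_def by blast
qed

lemma loc_const_mult:
  assumes "open \<Omega>" "bounded \<Omega>" and "v \<in> loc_const \<Omega> \<Gamma>D"
  shows "(\<lambda>x. k * v x) \<in> loc_const \<Omega> \<Gamma>D"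
proof -
  obtain c where c: "\<forall>x\<in>\<Omega>. \<exists>U. open U \<and> x \<in> U \<and> c constant_on (U \<inter> \<Omega>)" "AE x in lebesgue_on \<Omega>. v x = c x"
    using assms by (auto simp: loc_const_def)
  have "\<exists>U. open U \<and> x \<in> U \<and> (\<lambda>x. k * c x) constant_on (U \<inter> \<Omega>)" if "x \<in> \<Omega>" for x
    using c(1) that unfolding constant_on_def by metis
  moreover have "AE x in lebesgue_on \<Omega>. k * v x = k * c x"
    using c(2) by eventually_elim simp
  ultimately show ?thesis
    using assms H1D_mult unfolding loc_const_def by blast
qed

text \<open>The interior of a cell is an open box, hence connected, and it lies in the interior of
  the closure of \<Omega>. For a Lipschitz domain that is inside \<Omega>, which rules out slits
  through a cell; so \<open>c\<close> has a single value there.\<close>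

lemma loc_const_cellwise:
  assumes domain: "lipschitz_domain \<Omega>" and mesh: "cubical_partition \<Omega> \<Gamma>D \<Omega>h"
    and w: "w \<in> loc_const \<Omega> \<Gamma>D"
  shows "\<exists>k. AE x in lebesgue_on \<Omega>. w x = (\<Sum>K\<in>\<Omega>h. k K * indicator (interior K) x)"
proof -
  have div: "\<Omega>h division_of closure \<Omega>" using mesh by (simp add: cubical_partition_def)
  note finite = division_ofD(1)[OF div]
  obtain c where c: "\<forall>x\<in>\<Omega>. \<exists>U. open U \<and> x \<in> U \<and> c constant_on (U \<inter> \<Omega>)" "AE x in lebesgue_on \<Omega>. w x = c x"
    using w by (auto simp: loc_const_def)
  have "c constant_on interior K" if K: "K \<in> \<Omega>h" for K
  proof (rule locally_constant_imp_constant_on)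
    obtain a b where "K = cbox a b" using division_ofD(4)[OF div K] by blast
    then show "connected (interior K)" by (simp add: interior_cbox convex_connected convex_box)
    show "interior K \<subseteq> \<Omega>"
      using interior_mono[OF division_ofD(2)[OF div K]] lipschitz_domain_interior_closure[OF domain]
      by blast
  qed (use c in blast)
  then obtain k where k: "\<And>K x. K \<in> \<Omega>h \<Longrightarrow> x \<in> interior K \<Longrightarrow> c x = k K"
    unfolding constant_on_def by metis
  \<comment> \<open>The cell boundaries form a null set, so almost every point of \<Omega> is
    interior to some cell.\<close>
  have "AE x in lebesgue. \<forall>K\<in>\<Omega>h. x \<notin> K - interior K"
  proof (rule AE_ball_countable')
    fix K assume "K \<in> \<Omega>h"
    then obtain a b where "K = cbox a b" using division_ofD(4)[OF div] by blast
    then have "negligible (K - interior K)"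
      using negligible_frontier_interval by (simp add: interior_cbox)
    then show "AE x in lebesgue. x \<notin> K - interior K"
      by (intro AE_not_in) (simp add: negligible_iff_null_sets)
  qed (use finite in \<open>simp add: countable_finite\<close>)
  moreover have "\<Omega> \<in> sets lebesgue" using domain by (simp add: lipschitz_domain_def)
  ultimately have "AE x in lebesgue_on \<Omega>. \<forall>K\<in>\<Omega>h. x \<notin> K - interior K"
    by (simp add: AE_restrict_space_iff eventually_mono)
  moreover have "AE x in lebesgue_on \<Omega>. x \<in> \<Omega>" using AE_space[of "lebesgue_on \<Omega>"] by simp
  ultimately have "AE x in lebesgue_on \<Omega>. w x = (\<Sum>K\<in>\<Omega>h. k K * indicator (interior K) x)"
    using c(2)
  proof eventually_elim
    case (elim x)
    then obtain K where K: "K \<in> \<Omega>h" "x \<in> interior K"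
      using division_ofD(6)[OF div] closure_subset by blast
    have "x \<notin> interior K'" if "K' \<in> \<Omega>h - {K}" for K'
      using division_ofD(5)[OF div K(1), of K'] that K(2) by blast
    then have "(\<Sum>K\<in>\<Omega>h. k K * indicator (interior K) x) = k K * indicator (interior K) x"
      by (subst sum.remove[OF finite K(1)]) simp
    then show ?case using K k elim(3) by simp
  qed
  then show ?thesis by blast
qed

lemma proj_loc_const:
  assumes domain: "lipschitz_domain \<Omega>" and mesh: "cubical_partition \<Omega> \<Gamma>D \<Omega>h"
    and v: "v \<in> H1D \<Omega> \<Gamma>D"
  shows "proj_loc_const \<Omega> \<Gamma>D v \<in> loc_const \<Omega> \<Gamma>D"
    "perp_loc_const \<Omega> \<Gamma>D (\<lambda>x. v x - proj_loc_const \<Omega> \<Gamma>D v x)"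
proof -
  have \<Omega>: "open \<Omega>" "bounded \<Omega>" using domain by (simp_all add: lipschitz_domain_def)
  \<comment> \<open>The zero function, obtained as a multiple of \<open>v\<close>, shows that the
    space of locally constant functions is nonempty.\<close>
  have "(\<lambda>x. 0 * v x) \<in> H1D \<Omega> \<Gamma>D" by (rule H1D_mult[OF \<Omega> v])
  moreover have "\<exists>U. open U \<and> x \<in> U \<and> (\<lambda>x. 0) constant_on (U \<inter> \<Omega>)" for x
    by (intro exI[of _ UNIV]) (auto simp: constant_on_def)
  ultimately have "(\<lambda>x. 0) \<in> loc_const \<Omega> \<Gamma>D"
    by (auto simp: loc_const_def intro!: exI[of _ "\<lambda>x. 0"])
  then have "loc_const \<Omega> \<Gamma>D \<noteq> {}" by blast
  moreover have "finite \<Omega>h" using mesh by (auto simp: cubical_partition_def)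
  moreover have "loc_const \<Omega> \<Gamma>D \<subseteq> L2_space (lebesgue_on \<Omega>)" "v \<in> L2_space (lebesgue_on \<Omega>)"
    using v by (auto simp: loc_const_def H1D_def H1_def)
  ultimately have "\<exists>p\<in>loc_const \<Omega> \<Gamma>D. \<forall>w\<in>loc_const \<Omega> \<Gamma>D.
      L2_inner (lebesgue_on \<Omega>) (\<lambda>x. v x - p x) w = 0"
    using loc_const_add[OF \<Omega>] loc_const_mult[OF \<Omega>] loc_const_cellwise[OF domain mesh]
    by (intro L2_projection_exists[where S = \<Omega>h and e = "\<lambda>K. indicator (interior K)"])
  then have "\<exists>w. w \<in> loc_const \<Omega> \<Gamma>D \<and> perp_loc_const \<Omega> \<Gamma>D (\<lambda>x. v x - w x)"
    by (auto simp: perp_loc_const_def)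
  from someI_ex[OF this]
  show "proj_loc_const \<Omega> \<Gamma>D v \<in> loc_const \<Omega> \<Gamma>D"
    "perp_loc_const \<Omega> \<Gamma>D (\<lambda>x. v x - proj_loc_const \<Omega> \<Gamma>D v x)"
    by (simp_all add: proj_loc_const_def)
qed

text \<open>The projection is the difference of \<open>v\<close> and \<open>v\<close> minus its
  projection, both orthogonal to it, so its norm is zero. Orthogonality cannot see null functions,
  hence the conclusion almost everywhere.\<close>

lemma proj_loc_const_perp:
  assumes domain: "lipschitz_domain \<Omega>" and mesh: "cubical_partition \<Omega> \<Gamma>D \<Omega>h"
    and v: "v \<in> H1D \<Omega> \<Gamma>D" "perp_loc_const \<Omega> \<Gamma>D v"
  shows "AE x in lebesgue_on \<Omega>. proj_loc_const \<Omega> \<Gamma>D v x = 0"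
proof -
  define p where "p = proj_loc_const \<Omega> \<Gamma>D v"
  note p = proj_loc_const[OF domain mesh v(1), folded p_def]
  have L2: "v \<in> L2_space (lebesgue_on \<Omega>)" "p \<in> L2_space (lebesgue_on \<Omega>)"
    using v p by (auto simp: loc_const_def H1D_def H1_def)
  have "L2_inner (lebesgue_on \<Omega>) p p = L2_inner (lebesgue_on \<Omega>) v p - L2_inner (lebesgue_on \<Omega>) (\<lambda>x. v x - p x) p"
    using L2 by (simp add: L2_inner_diff_left)
  also have "\<dots> = 0" using p v(2) by (simp add: perp_loc_const_def)
  finally show ?thesis using L2_inner_self_eq_0D[OF L2(2)] by (simp add: p_def)
qed

section \<open>Functionals on $H^1(\Omega,\Gamma_D)$\<close>

text \<open>\<open>wgrad \<Omega> v\<close> is a choice that depends only on the class of \<open>v\<close>, so all multiples of a null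
  function have the same \<open>H1\<close>-norm, and a bounded homogeneous functional must vanish on it.\<close>

lemma Hminus1_null:
  assumes G: "G \<in> Hminus1 \<Omega> \<Gamma>D" and w: "w \<in> H1D \<Omega> \<Gamma>D" "AE x in lebesgue_on \<Omega>. w x = 0"
    and \<Omega>: "open \<Omega>" "bounded \<Omega>"
  shows "G w = 0"
proof (rule ccontr)
  assume "G w \<noteq> 0"
  obtain C where C: "\<And>v. v \<in> H1D \<Omega> \<Gamma>D \<Longrightarrow> \<bar>G v\<bar> \<le> C * H1_norm \<Omega> v"
    using G by (simp add: Hminus1_def) blast
  have wL2: "w \<in> L2_space (lebesgue_on \<Omega>)" using w by (simp add: H1D_def H1_def)
  note [measurable] = L2_space_measurable[OF wL2]
  have norm_eq: "H1_norm \<Omega> (\<lambda>x. t * w x) = H1_norm \<Omega> w" for t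
  proof -
    have "L2_inner (lebesgue_on \<Omega>) (\<lambda>x. t * w x) (\<lambda>x. t * w x) = L2_inner (lebesgue_on \<Omega>) w w"
      using w(2) by (intro L2_inner_cong_AE) auto
    moreover have "has_weak_gradient \<Omega> (\<lambda>x. t * w x) g \<longleftrightarrow> has_weak_gradient \<Omega> w g" for g
    proof -
      have "(\<integral>x. t * w x * partial_deriv i \<phi> x \<partial>lebesgue_on \<Omega>) = (\<integral>x. w x * partial_deriv i \<phi> x \<partial>lebesgue_on \<Omega>)"
        if "\<phi> \<in> test_functions \<Omega>" for i \<phi>
      proof -
        note [measurable] = L2_space_measurable[OF continuous_in_L2_space[OF \<Omega>
              test_functions_continuous_partial_deriv[OF \<Omega> that, of i]]]
        show ?thesis using w(2) by (intro integral_cong_AE) auto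
      qed
      then show ?thesis by (simp add: has_weak_gradient_def)
    qed
    ultimately show ?thesis by (simp add: H1_norm_def L2_norm_def wgrad_def)
  qed
  \<comment> \<open>Chosen so that \<open>t * G w\<close> exceeds the bound
    \<open>C * H1_norm \<Omega> w\<close> by exactly 1.\<close>
  define t where "t = (C * H1_norm \<Omega> w + 1) / G w"
  have "\<bar>t * G w\<bar> = \<bar>G (\<lambda>x. t * w x)\<bar>" using G w(1) by (simp add: Hminus1_def)
  also have "\<dots> \<le> C * H1_norm \<Omega> w" using C[OF H1D_mult[OF \<Omega> w(1), of t]] by (simp add: norm_eq)
  finally show False using \<open>G w \<noteq> 0\<close> by (simp add: t_def)
qed

lemma Hminus1_diff:
  assumes G: "G \<in> Hminus1 \<Omega> \<Gamma>D" and vw: "v \<in> H1D \<Omega> \<Gamma>D" "w \<in> H1D \<Omega> \<Gamma>D"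
    and \<Omega>: "open \<Omega>" "bounded \<Omega>"
  shows "G (\<lambda>x. v x - w x) = G v - G w"
proof -
  have "G (\<lambda>x. f x + g x) = G f + G g" if "f \<in> H1D \<Omega> \<Gamma>D" "g \<in> H1D \<Omega> \<Gamma>D" for f g
    using G that unfolding Hminus1_def by blast
  from this[OF vw(1) H1D_mult[OF \<Omega> vw(2), of "- 1"]]
  have "G (\<lambda>x. v x + (- 1) * w x) = G v + G (\<lambda>x. (- 1) * w x)" .
  moreover have "G (\<lambda>x. (- 1) * w x) = (- 1) * G w"
    using G vw unfolding Hminus1_def by blast
  ultimately show ?thesis by simp
qed

section \<open>The metric tensor and the error identity\<close>

context
  fixes \<Omega> :: "(real^'n) set" and A :: "real^'n \<Rightarrow> real^'n^'n"
  assumes metric: "admissible_metric \<Omega> A"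
begin

lemma A_inner_commute:
  "f \<in> L2_space (lebesgue_on \<Omega>) \<Longrightarrow> g \<in> L2_space (lebesgue_on \<Omega>) \<Longrightarrow> A_inner \<Omega> A f g = A_inner \<Omega> A g f"
  using metric unfolding admissible_metric_def scalar_product_on_L2_def by blast

lemma A_inner_add_left:
  assumes "f \<in> L2_space (lebesgue_on \<Omega>)" "g \<in> L2_space (lebesgue_on \<Omega>)" "h \<in> L2_space (lebesgue_on \<Omega>)"
  shows "A_inner \<Omega> A (\<lambda>x. f x + g x) h = A_inner \<Omega> A f h + A_inner \<Omega> A g h"
  using metric assms unfolding admissible_metric_def scalar_product_on_L2_def by blast

lemma A_inner_diff_left:
  assumes "f \<in> L2_space (lebesgue_on \<Omega>)" "g \<in> L2_space (lebesgue_on \<Omega>)" "h \<in> L2_space (lebesgue_on \<Omega>)"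
  shows "A_inner \<Omega> A (\<lambda>x. f x - g x) h = A_inner \<Omega> A f h - A_inner \<Omega> A g h"
proof -
  have "A_inner \<Omega> A (\<lambda>x. (- 1) *\<^sub>R g x) h = (- 1) * A_inner \<Omega> A g h"
    using metric assms unfolding admissible_metric_def scalar_product_on_L2_def by blast
  then show ?thesis
    using A_inner_add_left[OF assms(1) L2_space_scaleR[OF assms(2), of "- 1"] assms(3)] by simp
qed

lemma A_inner_diff_right:
  assumes "f \<in> L2_space (lebesgue_on \<Omega>)" "g \<in> L2_space (lebesgue_on \<Omega>)" "h \<in> L2_space (lebesgue_on \<Omega>)"
  shows "A_inner \<Omega> A f (\<lambda>x. g x - h x) = A_inner \<Omega> A f g - A_inner \<Omega> A f h"
  using A_inner_diff_left[OF assms(2,3,1)] assms L2_space_diff[OF assms(2,3)]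
  by (simp add: A_inner_commute[of f])

text \<open>Symmetry of \<open>A x\<close> almost everywhere moves the matrix to the other factor.
  The integrands are measurable because the matrix-vector product is continuous in both arguments
  jointly.\<close>

lemma div_op_eq_A_inner:
  assumes \<tau>: "\<tau> \<in> L2_space (lebesgue_on \<Omega>)" and v: "v \<in> H1 \<Omega>"
  shows "div_op \<Omega> (\<lambda>x. A x *v \<tau> x) v = - A_inner \<Omega> A \<tau> (wgrad \<Omega> v)"
proof -
  have A [measurable]: "A \<in> borel_measurable (lebesgue_on \<Omega>)"
    and sym: "AE x in lebesgue_on \<Omega>. transpose (A x) = A x"
    using metric by (auto simp: admissible_metric_def Linf_space_def)
  note [measurable] = L2_space_measurable[OF \<tau>] L2_space_measurable[OF wgrad(1)[OF v]]
  have mult [measurable]: "(\<lambda>x. A x *v f x) \<in> borel_measurable (lebesgue_on \<Omega>)"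
    if [measurable]: "f \<in> borel_measurable (lebesgue_on \<Omega>)" for f
  proof -
    have "continuous_on UNIV (\<lambda>p :: (real^'n^'n) \<times> (real^'n). fst p *v snd p)"
      unfolding matrix_vector_mult_def by (intro continuous_intros)
    from borel_measurable_continuous_Pair[OF A that this] show ?thesis by simp
  qed
  have "(\<integral>x. (A x *v \<tau> x) \<bullet> wgrad \<Omega> v x \<partial>lebesgue_on \<Omega>) = A_inner \<Omega> A \<tau> (wgrad \<Omega> v)"
    unfolding A_inner_def
  proof (rule integral_cong_AE)
    show "AE x in lebesgue_on \<Omega>. (A x *v \<tau> x) \<bullet> wgrad \<Omega> v x = \<tau> x \<bullet> (A x *v wgrad \<Omega> v x)"
      using sym
    proof eventually_elim
      case (elim x)
      show ?case
        using dot_lmul_matrix[of "\<tau> x" "A x" "wgrad \<Omega> v x"] vector_transpose_matrix[of "\<tau> x" "A x"] elim by simp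
    qed
  qed simp_all
  then show ?thesis by (simp add: div_op_def L2_inner_def)
qed

lemma A_inner_add_right:
  assumes "f \<in> L2_space (lebesgue_on \<Omega>)" "g \<in> L2_space (lebesgue_on \<Omega>)" "h \<in> L2_space (lebesgue_on \<Omega>)"
  shows "A_inner \<Omega> A f (\<lambda>x. g x + h x) = A_inner \<Omega> A f g + A_inner \<Omega> A f h"
  using A_inner_add_left[OF assms(2,3,1)] assms L2_space_add[OF assms(2,3)]
  by (simp add: A_inner_commute[of f])

lemma X_space_orthogonal:
  assumes "\<theta> \<in> X_space \<Omega> \<Gamma>D A" "v \<in> H1D \<Omega> \<Gamma>D"
  shows "A_inner \<Omega> A \<theta> (wgrad \<Omega> v) = 0"
  using assms div_op_eq_A_inner[of \<theta> v] by (simp add: X_space_def H1D_def)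

text \<open>One statement serves both (\<open>F\<close>, \<open>u\<close>, \<open>uh\<close>) and
  (\<open>J\<close>, \<open>z\<close>, \<open>zh\<close>). With \<open>P\<close> the projection,
  \<open>residual\<close> contains \<open>G v - G (P v)\<close> and \<open>solution\<close> contains
  \<open>G (v - P v)\<close>; \<open>Hminus1_diff\<close> identifies them once \<open>P v\<close> is
  known to lie in \<open>H1D\<close>.\<close>

lemma flux_error_in_X_space:
  assumes domain: "lipschitz_domain \<Omega>" and mesh: "cubical_partition \<Omega> \<Gamma>D \<Omega>h"
    and G: "G \<in> Hminus1 \<Omega> \<Gamma>D" and w: "w \<in> H1D \<Omega> \<Gamma>D" and wh: "wh \<in> H1D \<Omega> \<Gamma>D"
    and \<rho>: "\<rho> \<in> L2_space (lebesgue_on \<Omega>)"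
    and solution: "\<forall>v\<in>H1D \<Omega> \<Gamma>D. A_inner \<Omega> A (wgrad \<Omega> w) (wgrad \<Omega> v)
      = G (\<lambda>x. v x - proj_loc_const \<Omega> \<Gamma>D v x)"
    and residual: "\<forall>v\<in>H1D \<Omega> \<Gamma>D. - div_op \<Omega> (\<lambda>x. A x *v \<rho> x) v
      = G v - proj_functional \<Omega> \<Gamma>D G v + div_op \<Omega> (\<lambda>x. A x *v wgrad \<Omega> wh x) v"
  shows "(\<lambda>x. \<rho> x - (wgrad \<Omega> w x - wgrad \<Omega> wh x)) \<in> X_space \<Omega> \<Gamma>D A"
proof -
  let ?\<theta> = "\<lambda>x. \<rho> x - (wgrad \<Omega> w x - wgrad \<Omega> wh x)"
  have \<Omega>: "open \<Omega>" "bounded \<Omega>" using domain by (simp_all add: lipschitz_domain_def)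
  have H1: "v \<in> H1D \<Omega> \<Gamma>D \<Longrightarrow> v \<in> H1 \<Omega>" for v by (simp add: H1D_def)
  note grads = wgrad(1)[OF H1[OF w]] wgrad(1)[OF H1[OF wh]]
  have \<theta>: "?\<theta> \<in> L2_space (lebesgue_on \<Omega>)" by (rule L2_space_diff[OF \<rho> L2_space_diff[OF grads]])
  have "div_op \<Omega> (\<lambda>x. A x *v ?\<theta> x) v = 0" if v: "v \<in> H1D \<Omega> \<Gamma>D" for v
  proof -
    note v' = H1[OF v] and gv = wgrad(1)[OF H1[OF v]]
    have P: "proj_loc_const \<Omega> \<Gamma>D v \<in> H1D \<Omega> \<Gamma>D"
      using proj_loc_const(1)[OF domain mesh v] by (simp add: loc_const_def)
    have "A_inner \<Omega> A (wgrad \<Omega> w) (wgrad \<Omega> v) = G v - G (proj_loc_const \<Omega> \<Gamma>D v)"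
      using solution v Hminus1_diff[OF G v P \<Omega>] by simp
    moreover have "A_inner \<Omega> A \<rho> (wgrad \<Omega> v)
        = G v - G (proj_loc_const \<Omega> \<Gamma>D v) - A_inner \<Omega> A (wgrad \<Omega> wh) (wgrad \<Omega> v)"
      using bspec[OF residual v] div_op_eq_A_inner[OF \<rho> v'] div_op_eq_A_inner[OF grads(2) v']
      by (simp add: proj_functional_def)
    moreover have "A_inner \<Omega> A ?\<theta> (wgrad \<Omega> v) = A_inner \<Omega> A \<rho> (wgrad \<Omega> v)
        - (A_inner \<Omega> A (wgrad \<Omega> w) (wgrad \<Omega> v) - A_inner \<Omega> A (wgrad \<Omega> wh) (wgrad \<Omega> v))"
      using A_inner_diff_left[OF \<rho> L2_space_diff[OF grads] gv] A_inner_diff_left[OF grads gv] by simp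
    ultimately show ?thesis unfolding div_op_eq_A_inner[OF \<theta> v'] by simp
  qed
  then show ?thesis using \<theta> by (simp add: X_space_def)
qed

end

theorem mainTheorem2:
  fixes \<Omega> \<Gamma>D \<Gamma>N :: "(real^'n) set"
    and A :: "real^'n \<Rightarrow> real^'n^'n"
    and \<Omega>h :: "(real^'n) set set"
    and r :: nat
    and F J :: "(real^'n \<Rightarrow> real) \<Rightarrow> real"
    and u z uh zh :: "real^'n \<Rightarrow> real"
    and \<rho>h \<pi>h \<sigma>h \<tau>h :: "real^'n \<Rightarrow> real^'n"
  assumes domain: "lipschitz_domain \<Omega>"
    and boundary: "boundary_partition \<Omega> \<Gamma>D \<Gamma>N"
    and metric: "admissible_metric \<Omega> A"
    and mesh: "cubical_partition \<Omega> \<Gamma>D \<Omega>h"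
    and data: "F \<in> Hminus1 \<Omega> \<Gamma>D" "J \<in> Hminus1 \<Omega> \<Gamma>D"
    and u: "u \<in> H1D \<Omega> \<Gamma>D" "perp_loc_const \<Omega> \<Gamma>D u"
      "\<forall>v\<in>H1D \<Omega> \<Gamma>D. A_inner \<Omega> A (wgrad \<Omega> u) (wgrad \<Omega> v)
                       = F (\<lambda>x. v x - proj_loc_const \<Omega> \<Gamma>D v x)"
    and z: "z \<in> H1D \<Omega> \<Gamma>D" "perp_loc_const \<Omega> \<Gamma>D z"
      "\<forall>v\<in>H1D \<Omega> \<Gamma>D. A_inner \<Omega> A (wgrad \<Omega> z) (wgrad \<Omega> v)
                       = J (\<lambda>x. v x - proj_loc_const \<Omega> \<Gamma>D v x)"
    and uh: "uh \<in> Q_space r \<Omega> \<Gamma>D \<Omega>h"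
      "\<forall>v\<in>Q_space r \<Omega> \<Gamma>D \<Omega>h. A_inner \<Omega> A (wgrad \<Omega> uh) (wgrad \<Omega> v)
                       = F (\<lambda>x. v x - proj_loc_const \<Omega> \<Gamma>D v x)"
    and zh: "zh \<in> Q_space r \<Omega> \<Gamma>D \<Omega>h"
      "\<forall>v\<in>Q_space r \<Omega> \<Gamma>D \<Omega>h. A_inner \<Omega> A (wgrad \<Omega> zh) (wgrad \<Omega> v)
                       = J (\<lambda>x. v x - proj_loc_const \<Omega> \<Gamma>D v x)"
    and \<rho>h: "\<rho>h \<in> RT_space r \<Omega> \<Omega>h"
      "\<forall>v\<in>H1D \<Omega> \<Gamma>D. - div_op \<Omega> (\<lambda>x. A x *v \<rho>h x) v
         = F v - proj_functional \<Omega> \<Gamma>D F v + div_op \<Omega> (\<lambda>x. A x *v wgrad \<Omega> uh x) v"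
    and \<pi>h: "\<pi>h \<in> RT_space r \<Omega> \<Omega>h"
      "\<forall>v\<in>H1D \<Omega> \<Gamma>D. - div_op \<Omega> (\<lambda>x. A x *v \<pi>h x) v
         = J v - proj_functional \<Omega> \<Gamma>D J v + div_op \<Omega> (\<lambda>x. A x *v wgrad \<Omega> zh x) v"
    and \<sigma>h: "\<sigma>h = (\<lambda>x. \<rho>h x + wgrad \<Omega> uh x)"
    and \<tau>h: "\<tau>h = (\<lambda>x. \<pi>h x + wgrad \<Omega> zh x)"
  shows "\<exists>\<theta>h\<in>X_space \<Omega> \<Gamma>D A. \<exists>\<zeta>h\<in>X_space \<Omega> \<Gamma>D A.
      (AE x in lebesgue_on \<Omega>. \<rho>h x = (wgrad \<Omega> u x - wgrad \<Omega> uh x) + \<theta>h x) \<and>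
      (AE x in lebesgue_on \<Omega>. \<pi>h x = (wgrad \<Omega> z x - wgrad \<Omega> zh x) + \<zeta>h x) \<and>
      (\<forall>\<theta>'\<in>X_space \<Omega> \<Gamma>D A.
         (AE x in lebesgue_on \<Omega>. \<rho>h x = (wgrad \<Omega> u x - wgrad \<Omega> uh x) + \<theta>' x) \<longrightarrow>
         (AE x in lebesgue_on \<Omega>. \<theta>' x = \<theta>h x)) \<and>
      (\<forall>\<zeta>'\<in>X_space \<Omega> \<Gamma>D A.
         (AE x in lebesgue_on \<Omega>. \<pi>h x = (wgrad \<Omega> z x - wgrad \<Omega> zh x) + \<zeta>' x) \<longrightarrow>
         (AE x in lebesgue_on \<Omega>. \<zeta>' x = \<zeta>h x)) \<and>
      (perp_loc_const \<Omega> \<Gamma>D uh \<or> (\<forall>w\<in>loc_const \<Omega> \<Gamma>D. J w = 0) \<longrightarrow>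
         J (\<lambda>x. u x - uh x)
         = A_inner \<Omega> A (\<lambda>x. wgrad \<Omega> u x - wgrad \<Omega> uh x) (\<lambda>x. wgrad \<Omega> z x - wgrad \<Omega> zh x)) \<and>
      J (\<lambda>x. u x - uh x) + proj_functional \<Omega> \<Gamma>D J uh
        = A_inner \<Omega> A (\<lambda>x. wgrad \<Omega> u x - wgrad \<Omega> uh x) (\<lambda>x. wgrad \<Omega> z x - wgrad \<Omega> zh x) \<and>
      A_inner \<Omega> A (\<lambda>x. wgrad \<Omega> u x - wgrad \<Omega> uh x) (\<lambda>x. wgrad \<Omega> z x - wgrad \<Omega> zh x)
        = A_inner \<Omega> A (\<lambda>x. \<sigma>h x - wgrad \<Omega> uh x) (\<lambda>x. \<tau>h x - wgrad \<Omega> zh x)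
          - A_inner \<Omega> A \<theta>h \<zeta>h \<and>
      A_inner \<Omega> A (\<lambda>x. \<sigma>h x - wgrad \<Omega> uh x) (\<lambda>x. \<tau>h x - wgrad \<Omega> zh x)
          - A_inner \<Omega> A \<theta>h \<zeta>h
        = A_inner \<Omega> A \<rho>h \<pi>h - A_inner \<Omega> A \<theta>h \<zeta>h"
proof -
  have \<Omega>: "open \<Omega>" "bounded \<Omega>" using domain by (simp_all add: lipschitz_domain_def)
  have uh_H1D: "uh \<in> H1D \<Omega> \<Gamma>D" and zh_H1D: "zh \<in> H1D \<Omega> \<Gamma>D"
    using uh zh by (simp_all add: Q_space_def)
  have \<rho>_L2: "\<rho>h \<in> L2_space (lebesgue_on \<Omega>)" and \<pi>_L2: "\<pi>h \<in> L2_space (lebesgue_on \<Omega>)"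
    using \<rho>h \<pi>h by (simp_all add: RT_space_def)
  have grad: "wgrad \<Omega> v \<in> L2_space (lebesgue_on \<Omega>)" if "v \<in> H1D \<Omega> \<Gamma>D" for v
    using that by (intro wgrad) (simp add: H1D_def)
  note grads = grad[OF u(1)] grad[OF z(1)] grad[OF uh_H1D] grad[OF zh_H1D]
  note P = proj_loc_const(1)[OF domain mesh]
  have P_H1D: "proj_loc_const \<Omega> \<Gamma>D v \<in> H1D \<Omega> \<Gamma>D" if "v \<in> H1D \<Omega> \<Gamma>D" for v
    using P[OF that] by (simp add: loc_const_def)
  have J_P: "J (proj_loc_const \<Omega> \<Gamma>D v) = 0" if "v \<in> H1D \<Omega> \<Gamma>D" "perp_loc_const \<Omega> \<Gamma>D v" for v
    by (rule Hminus1_null[OF data(2) P_H1D[OF that(1)] proj_loc_const_perp[OF domain mesh that] \<Omega>])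
  define e where "e = (\<lambda>x. wgrad \<Omega> u x - wgrad \<Omega> uh x)"
  define d where "d = (\<lambda>x. wgrad \<Omega> z x - wgrad \<Omega> zh x)"
  define \<theta> where "\<theta> = (\<lambda>x. \<rho>h x - e x)"
  define \<zeta> where "\<zeta> = (\<lambda>x. \<pi>h x - d x)"
  have \<theta>: "\<theta> \<in> X_space \<Omega> \<Gamma>D A"
    unfolding \<theta>_def e_def
    by (rule flux_error_in_X_space[OF metric domain mesh data(1) u(1) uh_H1D \<rho>_L2 u(3) \<rho>h(2)])
  have \<zeta>: "\<zeta> \<in> X_space \<Omega> \<Gamma>D A"
    unfolding \<zeta>_def d_def
    by (rule flux_error_in_X_space[OF metric domain mesh data(2) z(1) zh_H1D \<pi>_L2 z(3) \<pi>h(2)])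
  have L2: "e \<in> L2_space (lebesgue_on \<Omega>)" "d \<in> L2_space (lebesgue_on \<Omega>)"
      "\<theta> \<in> L2_space (lebesgue_on \<Omega>)" "\<zeta> \<in> L2_space (lebesgue_on \<Omega>)"
    using grads L2_space_diff \<theta> \<zeta> unfolding e_def d_def X_space_def by blast+

  \<comment> \<open>Of the four terms, the two with \<open>zh\<close> cancel, and the two with
    \<open>z\<close> are evaluated by the dual equation and symmetry.\<close>
  have "A_inner \<Omega> A e d
      = (A_inner \<Omega> A (wgrad \<Omega> u) (wgrad \<Omega> z) - A_inner \<Omega> A (wgrad \<Omega> u) (wgrad \<Omega> zh))
      - (A_inner \<Omega> A (wgrad \<Omega> uh) (wgrad \<Omega> z) - A_inner \<Omega> A (wgrad \<Omega> uh) (wgrad \<Omega> zh))"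
    using grads L2(2) unfolding e_def A_inner_diff_left[OF metric grads(1,3) L2(2)]
    by (simp add: d_def A_inner_diff_right[OF metric])
  \<comment> \<open>Galerkin orthogonality: \<open>zh\<close> is a test function for the continuous
    and for the discrete primal problem, and the right-hand sides agree.\<close>
  also have "A_inner \<Omega> A (wgrad \<Omega> u) (wgrad \<Omega> zh) = A_inner \<Omega> A (wgrad \<Omega> uh) (wgrad \<Omega> zh)"
    using u(3) uh(2) zh(1) zh_H1D by simp
  also have "A_inner \<Omega> A (wgrad \<Omega> u) (wgrad \<Omega> z) = J (\<lambda>x. u x - proj_loc_const \<Omega> \<Gamma>D u x)"
    using A_inner_commute[OF metric grads(1,2)] z(3) u(1) by simp
  also have "\<dots> = J u"
    using Hminus1_diff[OF data(2) u(1) P_H1D[OF u(1)] \<Omega>] J_P[OF u(1,2)] by simp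
  also have "A_inner \<Omega> A (wgrad \<Omega> uh) (wgrad \<Omega> z) = J (\<lambda>x. uh x - proj_loc_const \<Omega> \<Gamma>D uh x)"
    using A_inner_commute[OF metric grads(3,2)] z(3) uh_H1D by simp
  \<comment> \<open>Unlike for \<open>u\<close>, the projection of \<open>uh\<close> may be nonzero,
    so its value under \<open>J\<close> stays and becomes the correction term.\<close>
  also have "\<dots> = J uh - J (proj_loc_const \<Omega> \<Gamma>D uh)"
    by (rule Hminus1_diff[OF data(2) uh_H1D P_H1D[OF uh_H1D] \<Omega>])
  finally have representation: "J (\<lambda>x. u x - uh x) + proj_functional \<Omega> \<Gamma>D J uh = A_inner \<Omega> A e d"
    using Hminus1_diff[OF data(2) u(1) uh_H1D \<Omega>] by (simp add: proj_functional_def)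
  \<comment> \<open>Orthogonality of \<open>uh\<close> makes its projection a null function; in the
    other case the projection lies in the space on which \<open>J\<close> vanishes.\<close>
  have normalized: "proj_functional \<Omega> \<Gamma>D J uh = 0"
    if "perp_loc_const \<Omega> \<Gamma>D uh \<or> (\<forall>w\<in>loc_const \<Omega> \<Gamma>D. J w = 0)"
    using that J_P[OF uh_H1D] P[OF uh_H1D] by (auto simp: proj_functional_def)

  \<comment> \<open>\<open>d\<close> is a difference of gradients of functions in
    \<open>H1D\<close>, and \<theta> is \<open>A\<close>-orthogonal to each of the two. The other
    mixed term is swapped by symmetry so that \<zeta> stands first.\<close>
  have "A_inner \<Omega> A \<theta> d = 0"
    unfolding d_def using \<theta> z(1) zh_H1D
    by (simp add: A_inner_diff_right[OF metric L2(3) grads(2,4)] X_space_orthogonal[OF metric])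
  moreover have "A_inner \<Omega> A e \<zeta> = 0"
    unfolding A_inner_commute[OF metric L2(1,4)] unfolding e_def using \<zeta> u(1) uh_H1D
    by (simp add: A_inner_diff_right[OF metric L2(4) grads(1,3)] X_space_orthogonal[OF metric])
  moreover have "A_inner \<Omega> A (\<lambda>x. e x + \<theta> x) (\<lambda>x. d x + \<zeta> x)
      = (A_inner \<Omega> A e d + A_inner \<Omega> A e \<zeta>) + (A_inner \<Omega> A \<theta> d + A_inner \<Omega> A \<theta> \<zeta>)"
    using A_inner_add_left[OF metric L2(1,3) L2_space_add[OF L2(2,4)]]
      A_inner_add_right[OF metric L2(1,2,4)] A_inner_add_right[OF metric L2(3,2,4)] by simp
  ultimately have estimator: "A_inner \<Omega> A e d = A_inner \<Omega> A \<rho>h \<pi>h - A_inner \<Omega> A \<theta> \<zeta>"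
    by (simp add: \<theta>_def \<zeta>_def)

  \<comment> \<open>The decomposition determines its remainder at almost every point, which is
    uniqueness of the L2 class.\<close>
  have unique: "AE x in lebesgue_on \<Omega>. g x = f x - h x"
    if "AE x in lebesgue_on \<Omega>. f x = h x + g x" for f g h :: "real^'n \<Rightarrow> real^'n"
    using that by eventually_elim simp
  \<comment> \<open>These are equalities of functions, so the expressions in
    \<open>\<sigma>h\<close> and \<open>\<tau>h\<close> turn literally into those in
    \<open>\<rho>h\<close> and \<open>\<pi>h\<close>.\<close>
  have \<sigma>\<tau>: "(\<lambda>x. \<sigma>h x - wgrad \<Omega> uh x) = \<rho>h" "(\<lambda>x. \<tau>h x - wgrad \<Omega> zh x) = \<pi>h"
    by (simp_all add: \<sigma>h \<tau>h)
  show ?thesis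
    unfolding \<sigma>\<tau> e_def[symmetric] d_def[symmetric]
  proof (rule bexI[OF _ \<theta>], rule bexI[OF _ \<zeta>], intro conjI ballI impI)
    show "AE x in lebesgue_on \<Omega>. \<rho>h x = wgrad \<Omega> u x - wgrad \<Omega> uh x + \<theta> x"
      by (simp add: \<theta>_def e_def)
    show "AE x in lebesgue_on \<Omega>. \<pi>h x = wgrad \<Omega> z x - wgrad \<Omega> zh x + \<zeta> x"
      by (simp add: \<zeta>_def d_def)
  next
    fix \<theta>' assume "AE x in lebesgue_on \<Omega>. \<rho>h x = wgrad \<Omega> u x - wgrad \<Omega> uh x + \<theta>' x"
    then show "AE x in lebesgue_on \<Omega>. \<theta>' x = \<theta> x" unfolding \<theta>_def e_def by (rule unique)
  next
    fix \<zeta>' assume "AE x in lebesgue_on \<Omega>. \<pi>h x = wgrad \<Omega> z x - wgrad \<Omega> zh x + \<zeta>' x"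
    then show "AE x in lebesgue_on \<Omega>. \<zeta>' x = \<zeta> x" unfolding \<zeta>_def d_def by (rule unique)
  qed (use representation normalized estimator in simp_all)
qed

end
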